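(* Let $\mathcal{A}$ be a finite set of indices and for every $i\in\mathcal{A}$ let $a_i,c_i$ be real numbers with $0<|a_i|<|c_i|<1/2$ such that $\sum_{i\in\mathcal{A}}|c_i||a_i|^{1/4}>1$ and $\sum_{i\in\mathcal{A}}|a_i|^{1/2}<1$. For $t=(t_i)_{i\in\mathcal{A}}\in\mathbb{R}^{2\#\mathcal{A}}$, $t_i=(t_{i,1},t_{i,2})$, let $$\Phi=\left\{f_i(x)=\begin{pmatrix} a_i & 0 \\ 0 & c_i\end{pmatrix}x+\begin{pmatrix}t_{i,1}\\t_{i,2}\end{pmatrix}\right\}_{i\in\mathcal{A}}$$ and denote by $X$ the attractor of $\Phi$. Then $0<\mathcal{H}^{s_0}(X)<\infty$ for Lebesgue-almost every $(t_{i})_{i\in\mathcal{A}}\in\mathbb{R}^{2\#\mathcal{A}}$, where $s_0$ is defined by $\sum_{i\in\mathcal{A}}|c_i||a_i|^{s_0-1}=1$.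
   Context: The attractor $X$ of $\Phi$ is the unique non-empty compact set $X\subset\mathbb{R}^2$ with $X=\bigcup_{i\in\mathcal{A}}f_i(X)$ (it depends on the translations). $\mathcal{H}^{s}$ denotes $s$-dimensional Hausdorff measure. *)

theory Defs
  imports "HOL-Analysis.Analysis"
begin

(* The diameter of a set raised to the power s, with the usual conventions that the empty set
   contributes 0 and that a one-point set contributes 1 when s = 0 (note that 0 powr 0 = 0). *)
definition diam_pow :: "real \<Rightarrow> 'a::metric_space set \<Rightarrow> ennreal" where
  "diam_pow s U = (if U = {} then 0 else if s = 0 then 1 else ennreal (diameter U powr s))"

(* Only bounded covering sets are admitted, as diameter is meaningful on bounded sets only. *)
definition hausdorff_premeasure :: "real \<Rightarrow> real \<Rightarrow> 'a::metric_space set \<Rightarrow> ennreal" where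
  "hausdorff_premeasure s \<delta> A =
     (INF U \<in> {U :: nat \<Rightarrow> 'a set. (\<forall>n. bounded (U n) \<and> diameter (U n) \<le> \<delta>) \<and> A \<subseteq> (\<Union>n. U n)}.
        \<Sum>n. diam_pow s (U n))"

(* The s-dimensional Hausdorff outer measure, for s \<ge> 0, without a normalising constant. *)
definition hausdorff_measure :: "real \<Rightarrow> 'a::metric_space set \<Rightarrow> ennreal" where
  "hausdorff_measure s A = (SUP \<delta> \<in> {0<..}. hausdorff_premeasure s \<delta> A)"

definition attractor :: "('i \<Rightarrow> 'a::metric_space \<Rightarrow> 'a) \<Rightarrow> 'a set" where
  "attractor f = (THE X. X \<noteq> {} \<and> compact X \<and> X = (\<Union>i. f i ` X))"

definition diag_affine ::
  "('i::finite \<Rightarrow> real) \<Rightarrow> ('i \<Rightarrow> real) \<Rightarrow> real ^ 2 ^ 'i \<Rightarrow> 'i \<Rightarrow> real ^ 2 \<Rightarrow> real ^ 2" where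
  "diag_affine a c t i x =
     (vector [vector [a i, 0], vector [0, c i]] :: real ^ 2 ^ 2) *v x + vector [t $ i $ 1, t $ i $ 2]"

end

theory Submission
  imports Defs "HOL-Library.Sublist"
begin

text \<open>
  Give the cylinder of a word \<open>w\<close> the mass \<open>p\<^sub>w = \<bar>c\<^sub>w\<bar> \<bar>a\<^sub>w\<bar> powr (s - 1)\<close>. Two facts hold for almost every
  translation vector. Since \<open>\<Sum>i. \<bar>a i\<bar> powr (1/2) < 1\<close>, the horizontal projections of the first
  level cylinders are disjoint: two cylinders \<open>u\<close>, \<open>v\<close> of comparable width overlap with probability at
  most a constant times \<open>sqrt \<bar>a\<^sub>u a\<^sub>v\<bar>\<close>, and this is summed over longer and longer pairs. Since moreover
  \<open>s > 5/4\<close>, there is \<open>\<kappa> > 0\<close> with \<open>\<Sum>i. (p i)\<^sup>2 * \<bar>c i\<bar> powr - (2 + \<kappa>) < 1\<close>; this Sobolev condition of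
  order above 2 makes the vertical projection of the mass distribution absolutely continuous with
  bounded density. A set of diameter \<open>r\<close> then meets essentially one cylinder \<open>w\<close> of width about \<open>r\<close>,
  whose mass in a horizontal strip of height \<open>r\<close> is at most a constant times
  \<open>p\<^sub>w * r / \<bar>c\<^sub>w\<bar> = \<bar>a\<^sub>w\<bar> powr (s - 1) * r\<close>, that is, of order \<open>r powr s\<close>. All masses are finite sums over the words
  of a given length, so no limit measure is needed.
\<close>

section \<open>Tent functions and the density of point masses\<close>

text \<open>An L2 bound has to become a pointwise one. Passing from scale \<open>2 * m\<close> to
  \<open>m\<close> changes the smoothed density by about the square root of
  \<open>haar_energy m / m ^ 3\<close>, so an energy of order \<open>m powr (3 + \<epsilon>)\<close>
  makes the changes summable over dyadic scales. Averaging over translations must therefore gain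
  more than two powers of \<open>m / |L v|\<close> for each pair of words, where \<open>L\<close> is
  the linear form giving the difference of their positions. Transversality yields one power, the
  measure of a strip. The weight \<open>bump\<close> yields two more, because the second difference
  in \<open>tent_diff\<close> can be moved onto it. This total of three is why
  \<open>\<kappa>\<close> is capped at 1. The exponents in the hypotheses meet in one estimate: as
  \<open>|a i| < |c i|\<close>, the term of the energy sum is at most
  \<open>|a i| powr (2 * (s - 1) - \<kappa>)\<close>, and \<open>s > 5/4\<close> leaves room to keep
  this exponent at least 1/2. The sum of the \<open>|a i| powr (1/2)\<close> thus controls both
  projections. In place of a limit measure, Fatou's lemma gives energy bounds at infinitely many
  levels, depending on \<open>t\<close>; other levels are treated through their descendants
  there.\<close>

definition tent :: "real \<Rightarrow> real \<Rightarrow> real" where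
  "tent m u = max 0 (m - \<bar>u\<bar>)"

text \<open>\<open>tent m (y - y')\<close> is the inner product of the indicators of the windows of
  length \<open>m\<close> ending at \<open>y\<close> and \<open>y'\<close>. \<open>tent_diff\<close>
  is the same for Haar functions, made of two adjacent windows with opposite signs.\<close>

definition tent_diff :: "real \<Rightarrow> real \<Rightarrow> real" where
  "tent_diff m u = 2 * tent m u - tent m (u + m) - tent m (u - m)"

lemma tent_nonneg: "0 \<le> tent m u"
  by (simp add: tent_def)

lemma tent_le: "0 \<le> m \<Longrightarrow> tent m u \<le> m"
  by (simp add: tent_def)

text \<open>A window of length \<open>2 * m\<close> consists of two windows of length
  \<open>m\<close>; this is the resulting two-scale relation between their correlations.\<close>

lemma tent_refine: "0 \<le> m \<Longrightarrow> tent (2 * m) u = tent m (u + m) + 2 * tent m u + tent m (u - m)"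
  unfolding tent_def by (auto simp: max_def abs_if)

lemma abs_tent_diff_le: "0 \<le> m \<Longrightarrow> \<bar>tent_diff m u\<bar> \<le> 2 * m"
  unfolding tent_diff_def tent_def by (auto simp: max_def abs_if)

lemma continuous_on_tent [continuous_intros]:
  "continuous_on S f \<Longrightarrow> continuous_on S (\<lambda>x. tent m (f x))"
  unfolding tent_def by (intro continuous_intros)

lemma continuous_on_tent_diff [continuous_intros]:
  "continuous_on S f \<Longrightarrow> continuous_on S (\<lambda>x. tent_diff m (f x))"
  unfolding tent_diff_def by (intro continuous_intros)

lemma has_integral_window_mult:
  assumes "0 < m"
  shows "has_bochner_integral lborel
           (\<lambda>z. indicat_real {y - m<..y} z * indicat_real {y' - m<..y'} z) (tent m (y - y'))"
proof -
  let ?A = "{max (y - m) (y' - m)<..min y y'}"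
  have "(\<lambda>z. indicat_real {y - m<..y} z * indicat_real {y' - m<..y'} z) = indicat_real ?A"
    by (auto simp: fun_eq_iff indicator_def)
  moreover have "emeasure lborel ?A < \<infinity>"
    by (rule emeasure_bounded_finite[OF bounded_subset[OF bounded_closed_interval greaterThanAtMost_subseteq_atLeastAtMost_iff[THEN iffD2]]]) auto
  then have "has_bochner_integral lborel (indicat_real ?A) (measure lborel ?A)"
    by (intro has_bochner_integral_real_indicator) auto
  moreover have "measure lborel ?A = tent m (y - y')"
    using assms by (cases "max (y - m) (y' - m) \<le> min y y'")
      (auto simp: tent_def max_def min_def abs_if split: if_splits)
  ultimately show ?thesis by simp
qed

lemma has_bochner_integral_mono_real:
  fixes f g :: "'a \<Rightarrow> real"
  assumes "has_bochner_integral M f x" "has_bochner_integral M g y" "\<And>z. f z \<le> g z"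
  shows "x \<le> y"
  using assms integral_mono[of M f g] by (auto simp: has_bochner_integral_iff)

context
  fixes S :: "'w set" and p y :: "'w \<Rightarrow> real"
  assumes fin: "finite S"
begin

text \<open>The tent has integral \<open>m ^ 2\<close>, so \<open>tent_mass m x / m ^ 2\<close> is
  the density of the point masses smoothed at scale \<open>m\<close>.\<close>

definition tent_mass :: "real \<Rightarrow> real \<Rightarrow> real" where
  "tent_mass m x = (\<Sum>w\<in>S. p w * tent m (x - y w))"

definition haar_energy :: "real \<Rightarrow> real" where
  "haar_energy m = (\<Sum>w\<in>S. \<Sum>w'\<in>S. p w * p w' * tent_diff m (y w - y w'))"

lemma tent_mass_refine:
  "0 \<le> m \<Longrightarrow> tent_mass (2 * m) x = tent_mass m (x + m) + 2 * tent_mass m x + tent_mass m (x - m)"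
  unfolding tent_mass_def by (subst tent_refine) (auto simp: algebra_simps sum.distrib sum_distrib_left)

text \<open>The energy is the squared L2-norm of the correlation \<open>D\<close> of the point masses with a Haar
  function of scale \<open>m\<close>, and differences of tent masses are averages of \<open>D\<close>.\<close>

lemma
  assumes m: "0 < m"
  shows haar_energy_nonneg: "0 \<le> haar_energy m"
    and tent_mass_diff_le: "0 < l \<Longrightarrow> 2 * \<bar>tent_mass m x - tent_mass m (x + m)\<bar> \<le> l * haar_energy m + m / l"
proof -
  define k where "k u z = indicat_real {u - m<..u} z" for u z
  define D where "D z = (\<Sum>w\<in>S. p w * (k (y w) z - k (y w - m) z))" for z
  have k: "has_bochner_integral lborel (\<lambda>z. k u z * k v z) (tent m (u - v))" for u v
    unfolding k_def by (rule has_integral_window_mult[OF m])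
  have "has_bochner_integral lborel
          (\<lambda>z. \<Sum>w\<in>S. \<Sum>w'\<in>S. p w * p w' * ((k (y w) z * k (y w') z - k (y w) z * k (y w' - m) z)
             - (k (y w - m) z * k (y w') z - k (y w - m) z * k (y w' - m) z)))
          (\<Sum>w\<in>S. \<Sum>w'\<in>S. p w * p w' * ((tent m (y w - y w') - tent m (y w - (y w' - m)))
             - (tent m (y w - m - y w') - tent m (y w - m - (y w' - m)))))"
    by (intro has_bochner_integral_sum has_bochner_integral_mult_right has_bochner_integral_diff k)
  also have "(\<lambda>z. \<Sum>w\<in>S. \<Sum>w'\<in>S. p w * p w' * ((k (y w) z * k (y w') z - k (y w) z * k (y w' - m) z)
             - (k (y w - m) z * k (y w') z - k (y w - m) z * k (y w' - m) z))) = (\<lambda>z. (D z)\<^sup>2)"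
    unfolding D_def power2_eq_square sum_product by (intro ext sum.cong refl) (simp add: algebra_simps)
  also have "(\<Sum>w\<in>S. \<Sum>w'\<in>S. p w * p w' * ((tent m (y w - y w') - tent m (y w - (y w' - m)))
             - (tent m (y w - m - y w') - tent m (y w - m - (y w' - m))))) = haar_energy m"
    unfolding haar_energy_def tent_diff_def by (intro sum.cong refl) (simp add: algebra_simps)
  finally have E: "has_bochner_integral lborel (\<lambda>z. (D z)\<^sup>2) (haar_energy m)" .
  show "0 \<le> haar_energy m"
    unfolding has_bochner_integral_integral_eq[OF E, symmetric] by (rule Bochner_Integration.integral_nonneg) simp
  show "2 * \<bar>tent_mass m x - tent_mass m (x + m)\<bar> \<le> l * haar_energy m + m / l" if l: "0 < l"
  proof -
    have "has_bochner_integral lborel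
           (\<lambda>z. \<Sum>w\<in>S. p w * (k x z * k (y w) z - k x z * k (y w - m) z))
           (\<Sum>w\<in>S. p w * (tent m (x - y w) - tent m (x - (y w - m))))"
      by (intro has_bochner_integral_sum has_bochner_integral_mult_right has_bochner_integral_diff k)
    also have "(\<lambda>z. \<Sum>w\<in>S. p w * (k x z * k (y w) z - k x z * k (y w - m) z)) = (\<lambda>z. k x z * D z)"
      unfolding D_def sum_distrib_left by (intro ext sum.cong refl) (simp add: algebra_simps)
    also have "(\<Sum>w\<in>S. p w * (tent m (x - y w) - tent m (x - (y w - m))))
        = tent_mass m x - tent_mass m (x + m)"
      unfolding tent_mass_def sum_subtractf[symmetric]
      by (intro sum.cong refl) (simp add: algebra_simps)
    finally have I: "has_bochner_integral lborel (\<lambda>z. k x z * D z) (tent_mass m x - tent_mass m (x + m))" .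
    have R: "has_bochner_integral lborel (\<lambda>z. l * (D z)\<^sup>2 + (k x z * k x z) / l) (l * haar_energy m + m / l)"
      using has_bochner_integral_add[OF has_bochner_integral_mult_right[OF E]
         has_bochner_integral_divide[OF k[of x x]], of l l] m
      by (simp add: tent_def)
    \<comment> \<open>A weighted arithmetic-geometric mean inequality takes the place of
      Cauchy-Schwarz; the weight \<open>l\<close> stays free and is chosen per scale later.\<close>
    have amgm: "2 * \<bar>u * v\<bar> \<le> l * v\<^sup>2 + u * u / l" for u v :: real
    proof -
      have "0 \<le> (l * \<bar>v\<bar> - \<bar>u\<bar>)\<^sup>2 / l" using l by simp
      also have "\<dots> = l * v\<^sup>2 + u * u / l - 2 * \<bar>u * v\<bar>"
        using l by (simp add: power2_eq_square field_simps abs_mult)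
      finally show ?thesis by simp
    qed
    have "2 * (tent_mass m x - tent_mass m (x + m)) \<le> l * haar_energy m + m / l"
      by (rule has_bochner_integral_mono_real[OF has_bochner_integral_mult_right[OF I] R])
        (use amgm[of "k x _" "D _"] in \<open>smt (verit) abs_ge_self\<close>)
    moreover have "- 2 * (tent_mass m x - tent_mass m (x + m)) \<le> l * haar_energy m + m / l"
      by (rule has_bochner_integral_mono_real[OF has_bochner_integral_mult_right[OF I] R])
        (use amgm[of "k x _" "D _"] in \<open>smt (verit) abs_ge_self\<close>)
    ultimately show ?thesis by linarith
  qed
qed

text \<open>Induction from scale 1, where the tent mass is at most the total mass. By the two-scale
  relation, \<open>4 * tent_mass m x\<close> differs from \<open>tent_mass (2 * m) x\<close> by two
  neighbour differences, which the energy controls; the 4 is the ratio of \<open>(2 * m) ^ 2\<close>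
  to \<open>m ^ 2\<close>.\<close>

lemma tent_mass_dyadic_le:
  assumes p: "\<And>w. w \<in> S \<Longrightarrow> 0 \<le> p w" "(\<Sum>w\<in>S. p w) \<le> 1"
    and E: "\<And>n. 1 \<le> n \<Longrightarrow> n \<le> N \<Longrightarrow> haar_energy ((1/2)^n) \<le> C * ((1/2)^n) powr (3 + \<epsilon>)"
    and "0 \<le> C" "n \<le> N"
  shows "tent_mass ((1/2)^n) x \<le> (1 + (C + 1) / 4 * (\<Sum>k=1..n. ((1/2)^k) powr (\<epsilon>/2))) * ((1/2)^n)\<^sup>2"
  using \<open>n \<le> N\<close>
proof (induction n arbitrary: x)
  case 0
  have "tent_mass 1 x \<le> (\<Sum>w\<in>S. p w * 1)"
    unfolding tent_mass_def by (intro sum_mono mult_left_mono tent_le p) auto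
  then show ?case using p by simp
next
  case (Suc n)
  define m :: real where "m = (1/2)^Suc n"
  define B where "B = 1 + (C + 1) / 4 * (\<Sum>k=1..n. ((1/2)^k) powr (\<epsilon>/2))"
  have m: "0 < m" "(1/2)^n = 2 * m" by (auto simp: m_def)
  \<comment> \<open>This choice balances the two terms \<open>l * haar_energy m\<close> and
    \<open>m / l\<close>: both are bounded by multiples of
    \<open>m powr (2 + \<epsilon>/2)\<close>.\<close>
  define l where "l = m powr (- 1 - \<epsilon>/2)"
  have l: "0 < l" using m by (simp add: l_def)
  have E': "haar_energy m \<le> C * m powr (3 + \<epsilon>)"
    using E[of "Suc n"] Suc.prems unfolding m_def by simp
  have "l * haar_energy m \<le> l * (C * m powr (3 + \<epsilon>))" using E' l by simp
  also have "\<dots> = C * m\<^sup>2 * m powr (\<epsilon>/2)"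
  proof -
    have "l * m powr (3 + \<epsilon>) = m powr (2 + \<epsilon>/2)"
      unfolding l_def by (simp add: powr_add[symmetric])
    also have "\<dots> = m\<^sup>2 * m powr (\<epsilon>/2)" using m by (simp add: powr_add)
    finally show ?thesis by simp
  qed
  finally have 1: "l * haar_energy m \<le> C * m\<^sup>2 * m powr (\<epsilon>/2)" .
  have 2: "m / l = m\<^sup>2 * m powr (\<epsilon>/2)"
  proof -
    have "m / l = m powr 1 / m powr (- 1 - \<epsilon>/2)" using m(1) unfolding l_def by (subst powr_one) auto
    also have "\<dots> = m powr (2 + \<epsilon>/2)" unfolding powr_diff[symmetric] by (rule arg_cong[where f = "\<lambda>e. m powr e"]) simp
    also have "\<dots> = m\<^sup>2 * m powr (\<epsilon>/2)" using m by (simp add: powr_add)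
    finally show ?thesis .
  qed
  have "tent_mass (2 * m) x \<le> B * (2 * m)\<^sup>2"
    using Suc.IH[of x] Suc.prems unfolding B_def m(2) by simp
  moreover have "4 * tent_mass m x = tent_mass (2 * m) x + (tent_mass m x - tent_mass m (x + m))
      - (tent_mass m (x - m) - tent_mass m (x - m + m))"
    using tent_mass_refine[of m x] m by simp
  moreover have "2 * \<bar>tent_mass m x - tent_mass m (x + m)\<bar> \<le> (C + 1) * m\<^sup>2 * m powr (\<epsilon>/2)"
    using tent_mass_diff_le[OF m(1) l, of x] 1 2 by (simp add: algebra_simps)
  moreover have "2 * \<bar>tent_mass m (x - m) - tent_mass m (x - m + m)\<bar> \<le> (C + 1) * m\<^sup>2 * m powr (\<epsilon>/2)"
    using tent_mass_diff_le[OF m(1) l, of "x - m"] 1 2 by (simp add: algebra_simps)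
  moreover have "4 * T \<le> K + J" if "U \<le> K" "4 * T = U + V - V'" "2 * \<bar>V\<bar> \<le> J" "2 * \<bar>V'\<bar> \<le> J"
    for T U V V' K J :: real using that by linarith
  ultimately have "4 * tent_mass m x \<le> B * (2 * m)\<^sup>2 + (C + 1) * m\<^sup>2 * m powr (\<epsilon>/2)"
    by blast
  then have "tent_mass m x \<le> (B + (C + 1) / 4 * m powr (\<epsilon>/2)) * m\<^sup>2"
    by (simp add: power2_eq_square field_simps)
  then show ?case
    unfolding B_def m_def by (simp add: algebra_simps)
qed

end

lemma sum_dyadic_powr_le:
  assumes "0 < \<epsilon>"
  shows "(\<Sum>k=1..n. ((1/2::real)^k) powr \<epsilon>) \<le> 1 / (1 - (1/2) powr \<epsilon>)"
proof -
  define q :: real where "q = (1/2) powr \<epsilon>"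
  have q: "0 \<le> q" "q < 1"
    using assms powr_less_mono2[of \<epsilon> "1/2" 1] by (auto simp: q_def)
  have "(\<Sum>k=1..n. ((1/2::real)^k) powr \<epsilon>) = (\<Sum>k=1..n. q ^ k)"
    unfolding q_def by (intro sum.cong refl) (simp add: powr_realpow[symmetric] powr_powr powr_power mult.commute)
  also have "\<dots> \<le> (\<Sum>k. q ^ k)"
    using q by (intro sum_le_suminf) (auto intro: summable_geometric)
  also have "\<dots> = 1 / (1 - q)" using q by (subst suminf_geometric) auto
  finally show ?thesis by (simp add: q_def)
qed

section \<open>Words\<close>

definition words :: "nat \<Rightarrow> 'i list set" where
  "words n = {w. length w = n}"

definition wprod :: "('i \<Rightarrow> real) \<Rightarrow> 'i list \<Rightarrow> real" where
  "wprod r w = prod_list (map r w)"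

lemma wprod_simps [simp]:
  "wprod r [] = 1" "wprod r (i # w) = r i * wprod r w" "wprod r (u @ w) = wprod r u * wprod r w"
  by (simp_all add: wprod_def)

lemma finite_words [simp]: "finite (words n :: 'i::finite list set)"
  using finite_lists_length_eq[of "UNIV :: 'i set" n] by (simp add: words_def)

lemma words_0 [simp]: "words 0 = {[]}"
  by (auto simp: words_def)

lemma sum_words_Suc:
  fixes f :: "'i::finite list \<Rightarrow> 'b::comm_monoid_add"
  shows "(\<Sum>w\<in>words (Suc n). f w) = (\<Sum>i\<in>UNIV. \<Sum>w\<in>words n. f (i # w))"
proof -
  have "(\<Sum>w\<in>words (Suc n). f w) = (\<Sum>(i, w)\<in>UNIV \<times> words n. f (i # w))"
    by (rule sum.reindex_bij_witness[where i = "\<lambda>(i, w). i # w" and j = "\<lambda>w. (hd w, tl w)"])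
      (auto simp: words_def length_Suc_conv)
  then show ?thesis by (simp add: sum.cartesian_product)
qed

lemma sum_wprod: "(\<Sum>w\<in>words n. wprod p w) = (\<Sum>i\<in>UNIV. p i) ^ n" for p :: "'i::finite \<Rightarrow> real"
  by (induction n) (simp_all add: sum_words_Suc sum_distrib_left[symmetric] sum_distrib_right)

lemma wprod_nonneg: "(\<And>i. 0 \<le> p i) \<Longrightarrow> 0 \<le> wprod p w"
  by (induction w) auto

lemma wprod_pos: "(\<And>i. 0 < p i) \<Longrightarrow> 0 < wprod p w"
  by (induction w) auto

lemma abs_wprod: "\<bar>wprod p w\<bar> = wprod (\<lambda>i. \<bar>p i\<bar>) w"
  by (induction w) (auto simp: abs_mult)

lemma wprod_mono: "(\<And>i. 0 \<le> p i) \<Longrightarrow> (\<And>i. p i \<le> q i) \<Longrightarrow> wprod p w \<le> wprod q w"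
proof (induction w)
  case (Cons i w)
  then show ?case
    using wprod_nonneg[of p w] by (auto intro!: mult_mono order.trans[OF Cons.prems(1) Cons.prems(2)])
qed simp

lemma wprod_const: "wprod (\<lambda>_. q) w = q ^ length w"
  by (induction w) auto

lemma wprod_mult: "wprod (\<lambda>i. p i * q i) w = wprod p w * wprod q w"
  by (induction w) auto

lemma wprod_powr: "(\<And>i. 0 \<le> p i) \<Longrightarrow> wprod (\<lambda>i. p i powr e) w = wprod p w powr e"
  by (induction w) (auto simp: powr_mult wprod_nonneg)

text \<open>Split off the first letters. Equal ones contribute at most \<open>\<theta>\<close> times
  the sum for words shorter by one; distinct ones leave an empty common prefix and contribute at
  most 1 in total. The bound is the fixed point of \<open>x = \<theta> * x + 1\<close>.\<close>

lemma sum_words_common_prefix_le: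
  fixes p q :: "'i::finite \<Rightarrow> real"
  assumes p: "\<And>i. 0 \<le> p i" "(\<Sum>i\<in>UNIV. p i) = 1" and q: "\<And>i. 0 \<le> q i"
    and \<theta>: "(\<Sum>i\<in>UNIV. (p i)\<^sup>2 * q i) \<le> \<theta>" "\<theta> < 1"
  shows "(\<Sum>u\<in>words n. \<Sum>v\<in>words n. wprod p u * wprod p v * wprod q (longest_common_prefix u v))
           \<le> 1 / (1 - \<theta>)"
proof (induction n)
  have \<theta>0: "0 \<le> \<theta>" using \<theta>(1) q by (intro order.trans[OF _ \<theta>(1)] sum_nonneg) auto
  {
    case 0
    show ?case using \<theta> \<theta>0 by simp
  next
    case (Suc n)
    define T where "T = (\<Sum>u\<in>words n. \<Sum>v\<in>words n. wprod p u * wprod p v * wprod q (longest_common_prefix u v))"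
    have T0: "0 \<le> T"
      unfolding T_def by (intro sum_nonneg mult_nonneg_nonneg wprod_nonneg p q)
    have one: "(\<Sum>u\<in>words n. \<Sum>v\<in>words n. wprod p u * wprod p v) = 1"
      by (simp add: sum_product[symmetric] sum_wprod p)
    have "(\<Sum>u\<in>words (Suc n). \<Sum>v\<in>words (Suc n). wprod p u * wprod p v * wprod q (longest_common_prefix u v))
       = (\<Sum>i\<in>UNIV. \<Sum>u\<in>words n. \<Sum>j\<in>UNIV. \<Sum>v\<in>words n. wprod p (i#u) * wprod p (j#v) * wprod q (longest_common_prefix (i#u) (j#v)))"
      by (simp add: sum_words_Suc)
    also have "\<dots> = (\<Sum>i\<in>UNIV. \<Sum>j\<in>UNIV. \<Sum>u\<in>words n. \<Sum>v\<in>words n. wprod p (i#u) * wprod p (j#v) * wprod q (longest_common_prefix (i#u) (j#v)))"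
      by (intro sum.cong refl sum.swap)
    \<comment> \<open>The term \<open>p i * p j\<close> is granted on the diagonal too, so that this
      part sums to exactly 1.\<close>
    also have "\<dots> \<le> (\<Sum>i\<in>UNIV. \<Sum>j\<in>UNIV. (if i = j then (p i)\<^sup>2 * q i * T else 0) + p i * p j)"
    proof (intro sum_mono)
      fix i j :: 'i
      show "(\<Sum>u\<in>words n. \<Sum>v\<in>words n. wprod p (i#u) * wprod p (j#v) * wprod q (longest_common_prefix (i#u) (j#v)))
         \<le> (if i = j then (p i)\<^sup>2 * q i * T else 0) + p i * p j"
      proof (cases "i = j")
        case True
        have "(\<Sum>u\<in>words n. \<Sum>v\<in>words n. wprod p (i#u) * wprod p (j#v) * wprod q (longest_common_prefix (i#u) (j#v)))
            = (p i)\<^sup>2 * q i * T"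
          unfolding T_def sum_distrib_left by (intro sum.cong refl) (simp add: True power2_eq_square)
        then show ?thesis using True p by simp
      next
        case False
        have "(\<Sum>u\<in>words n. \<Sum>v\<in>words n. wprod p (i#u) * wprod p (j#v) * wprod q (longest_common_prefix (i#u) (j#v)))
            = (\<Sum>u\<in>words n. \<Sum>v\<in>words n. p i * p j * (wprod p u * wprod p v))"
          using False by (intro sum.cong refl) simp
        also have "\<dots> = p i * p j"
          using one by (simp only: sum_distrib_left[symmetric] mult_1_right)
        finally show ?thesis using False by simp
      qed
    qed
    also have "\<dots> = (\<Sum>i\<in>UNIV. (p i)\<^sup>2 * q i) * T + 1"
      using p(2) by (simp add: sum.distrib sum_distrib_right[symmetric] sum_product[symmetric])
    also have "\<dots> \<le> \<theta> * (1 / (1 - \<theta>)) + 1"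
      using \<theta> T0 \<theta>0 Suc.IH by (intro add_right_mono mult_mono) (auto simp: T_def)
    also have "\<dots> = 1 / (1 - \<theta>)" using \<theta> by (simp add: field_simps)
    finally show ?case .
  }
qed

section \<open>Averaging over translations\<close>

lemma strip_lmeasurable:
  fixes L :: "'a::euclidean_space \<Rightarrow> real"
  assumes "linear L"
  shows "{t \<in> cball 0 R. \<bar>L t\<bar> \<le> h} \<in> lmeasurable"
proof -
  have "closed {t. \<bar>L t\<bar> \<le> h}"
    by (intro closed_Collect_le continuous_intros linear_continuous_on linear_conv_bounded_linear[THEN iffD1] assms)
  then have "compact (cball 0 R \<inter> {t. \<bar>L t\<bar> \<le> h})"
    by (intro compact_Int_closed compact_cball)
  moreover have "cball 0 R \<inter> {t. \<bar>L t\<bar> \<le> h} = {t \<in> cball 0 R. \<bar>L t\<bar> \<le> h}" by auto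
  ultimately show ?thesis by (simp add: lmeasurable_compact)
qed

text \<open>About \<open>\<bar>L v\<bar> / h\<close> translates of the strip along \<open>v\<close> are disjoint and fit in a bounded ball.\<close>

lemma strip_measure_le:
  obtains C where "0 < C"
    "\<And>(L :: 'a::euclidean_space \<Rightarrow> real) v h. linear L \<Longrightarrow> norm v \<le> 2 \<Longrightarrow> L v \<noteq> 0 \<Longrightarrow> 0 < h \<Longrightarrow>
       measure lebesgue {t \<in> cball 0 R. \<bar>L t\<bar> \<le> h} \<le> C * (h / \<bar>L v\<bar>)"
proof
  define V where "V = measure lebesgue (cball (0::'a) (R + 2))"
  have V: "0 \<le> V" by (simp add: V_def)
  show "0 < 6 * V + 1" using V by simp
  fix L :: "'a \<Rightarrow> real" and v and h :: real
  assume L: "linear L" and v: "norm v \<le> 2" "L v \<noteq> 0" and h: "0 < h"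
  define S where "S = {t \<in> cball 0 R. \<bar>L t\<bar> \<le> h}"
  have S: "S \<in> lmeasurable" unfolding S_def by (rule strip_lmeasurable[OF L])
  define \<kappa> where "\<kappa> = \<bar>L v\<bar>"
  have \<kappa>: "0 < \<kappa>" using v by (simp add: \<kappa>_def)
  have mono: "measure lebesgue T \<le> V" if "T \<subseteq> cball 0 (R + 2)" "T \<in> sets lebesgue" for T :: "'a set"
    unfolding V_def by (rule measure_mono_fmeasurable) (use that in auto)
  have "measure lebesgue S \<le> 6 * V * (h / \<kappa>)"
  proof (cases "3 * h \<le> \<kappa>")
    case False
    have "measure lebesgue S \<le> V"
      by (rule mono) (use S in \<open>auto simp: S_def\<close>)
    also have "V * 1 \<le> V * (6 * (h / \<kappa>))"
      using False \<kappa> V by (intro mult_left_mono) (auto simp: field_simps)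
    finally show ?thesis by (simp add: ac_simps)
  next
    case True
    \<comment> \<open>Rounding \<open>\<kappa> / (3 * h)\<close>, which is at least 1, down loses at
      most half of it; hence the 6 in the lower bound for \<open>K\<close>.\<close>
    define K where "K = nat \<lfloor>\<kappa> / (3 * h)\<rfloor>"
    have Kge: "\<kappa> / (6 * h) \<le> K" and Kle: "K * (3 * h / \<kappa>) \<le> 1"
    proof -
      have "1 \<le> \<kappa> / (3 * h)" using True h by simp
      then have "\<kappa> / (3 * h) - 1 < K" "1 \<le> K" "K \<le> \<kappa> / (3 * h)" 
        unfolding K_def by linarith+
      moreover from this(1,2) h have "\<kappa> < 3 * h * K + 3 * h" "3 * h * 1 \<le> 3 * h * real K"
        by (simp add: field_simps) (intro mult_left_mono, use \<open>1 \<le> K\<close> h in auto)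
      then have "\<kappa> \<le> 6 * h * K" by linarith
      ultimately show "\<kappa> / (6 * h) \<le> K" "K * (3 * h / \<kappa>) \<le> 1" using h \<kappa> by (auto simp: field_simps)
    qed
    \<comment> \<open>Consecutive translates shift \<open>L\<close> by \<open>3 * h\<close>, more
      than the strip width \<open>2 * h\<close>, so they are disjoint; the total shift is at most
      \<open>v\<close>, whose norm is at most 2.\<close>
    define T where "T k = (+) ((real k * (3 * h / \<kappa>)) *\<^sub>R v) ` S" for k :: nat
    have TM: "T k \<in> lmeasurable" for k unfolding T_def by (rule measurable_translation[OF S])
    have Tdisj: "disjnt (T k) (T l)" if "k \<noteq> l" for k l
    proof -
      have False if "x \<in> T k" "x \<in> T l" for x
      proof -
        define \<sigma> where "\<sigma> = L v / \<kappa>"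
        have \<sigma>: "\<bar>\<sigma>\<bar> = 1" using \<kappa> unfolding \<sigma>_def \<kappa>_def by simp
        have "\<exists>t. \<bar>t\<bar> \<le> h \<and> L x = real j * (3 * h) * \<sigma> + t" if "x \<in> T j" for j
        proof -
          obtain s where s: "s \<in> S" "x = (real j * (3 * h / \<kappa>)) *\<^sub>R v + s"
            using \<open>x \<in> T j\<close> by (auto simp: T_def)
          then show ?thesis
            using linear_add[OF L] linear_cmul[OF L] by (auto simp: S_def \<sigma>_def intro!: exI[of _ "L s"])
        qed
        from this[OF \<open>x \<in> T k\<close>] this[OF \<open>x \<in> T l\<close>] obtain t t' where
          "\<bar>t\<bar> \<le> h" "\<bar>t'\<bar> \<le> h" "real k * (3 * h) * \<sigma> + t = real l * (3 * h) * \<sigma> + t'" by auto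
        then have "\<bar>(real k - real l) * (3 * h) * \<sigma>\<bar> \<le> 2 * h" by (simp add: algebra_simps)
        then have "\<bar>real k - real l\<bar> * (3 * h) \<le> 2 * h" using h \<sigma> by (simp add: abs_mult)
        moreover have "1 \<le> \<bar>real k - real l\<bar>" using \<open>k \<noteq> l\<close> by linarith
        then have "1 * (3 * h) \<le> \<bar>real k - real l\<bar> * (3 * h)" using h by (intro mult_right_mono) auto
        ultimately show False using h by linarith
      qed
      then show ?thesis by (auto simp: disjnt_def)
    qed
    have "real K * measure lebesgue S = (\<Sum>k<K. measure lebesgue (T k))"
      by (simp add: T_def measure_translation)
    also have "\<dots> = measure lebesgue (\<Union>k<K. T k)"
      using TM Tdisj by (intro measure_UNION'[symmetric]) (auto simp: pairwise_def)
    also have "\<dots> \<le> V"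
    proof (rule mono)
      show "(\<Union>k<K. T k) \<subseteq> cball 0 (R + 2)"
      proof clarsimp
        fix k x assume k: "k < K" and "x \<in> T k"
        then obtain s where s: "norm s \<le> R" "x = (real k * (3 * h / \<kappa>)) *\<^sub>R v + s"
          by (auto simp: T_def S_def)
        have "real k * (3 * h / \<kappa>) \<le> real K * (3 * h / \<kappa>)"
          using k h \<kappa> by (intro mult_right_mono) auto
        then have "real k * (3 * h / \<kappa>) \<le> 1" using Kle by linarith
        then have "real k * (3 * h / \<kappa>) * norm v \<le> 1 * 2"
          using v h \<kappa> by (intro mult_mono) auto
        moreover have "norm x \<le> real k * (3 * h / \<kappa>) * norm v + norm s"
          unfolding s(2) using norm_triangle_ineq[of "(real k * (3 * h / \<kappa>)) *\<^sub>R v" s] h \<kappa> by simp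
        ultimately show "norm x \<le> R + 2" using s by linarith
      qed
    qed (use TM in auto)
    finally have *: "real K * measure lebesgue S \<le> V" .
    have "\<kappa> / (6 * h) * measure lebesgue S \<le> real K * measure lebesgue S"
      using Kge by (intro mult_right_mono) auto
    with * have "\<kappa> / (6 * h) * measure lebesgue S \<le> V" by linarith
    then show ?thesis using h \<kappa> by (simp add: field_simps)
  qed
  also have "\<dots> \<le> (6 * V + 1) * (h / \<kappa>)" using h \<kappa> by (simp add: algebra_simps)
  finally show "measure lebesgue {t \<in> cball 0 R. \<bar>L t\<bar> \<le> h} \<le> (6 * V + 1) * (h / \<bar>L v\<bar>)"
    by (simp add: S_def \<kappa>_def)
qed

text \<open>Squaring the positive part makes the gradient Lipschitz across the sphere of radius
  \<open>R\<close>, which is what second differences of quadratic size require; the indicator of the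
  ball would not do.\<close>

definition bump :: "real \<Rightarrow> 'a::real_inner \<Rightarrow> real" where
  "bump R t = (max 0 (R\<^sup>2 - t \<bullet> t))\<^sup>2"

lemma bump_nonneg: "0 \<le> bump R t"
  by (simp add: bump_def)

lemma bump_pos: "norm t < R \<Longrightarrow> 0 < bump R t"
  using power_strict_mono[of "norm t" R 2] unfolding bump_def power2_norm_eq_inner[symmetric]
  by (simp add: max_def)

lemma bump_eq_0: "0 \<le> R \<Longrightarrow> R < norm t \<Longrightarrow> bump R t = 0"
  using power_mono[of R "norm t" 2] unfolding bump_def power2_norm_eq_inner[symmetric] by simp

lemma continuous_on_bump [continuous_intros]:
  "continuous_on S f \<Longrightarrow> continuous_on S (\<lambda>x. bump R (f x))"
  unfolding bump_def by (intro continuous_intros)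

text \<open>The derivative \<open>2 * max 0 x\<close> of \<open>(max 0 x)^2\<close> is Lipschitz
  with constant 2, which gives this first-order Taylor remainder.\<close>

lemma pos_part_square_taylor:
  fixes x y :: real
  shows "\<bar>(max 0 y)\<^sup>2 - (max 0 x)\<^sup>2 - 2 * max 0 x * (y - x)\<bar> \<le> (y - x)\<^sup>2"
proof -
  consider "0 \<le> x" "0 \<le> y" | "0 \<le> x" "y < 0" | "x < 0" "0 \<le> y" | "x < 0" "y < 0" by linarith
  then show ?thesis
  proof cases
    case 1
    then have "(max 0 y)\<^sup>2 - (max 0 x)\<^sup>2 - 2 * max 0 x * (y - x) = (y - x)\<^sup>2"
      by (simp add: max_def power2_eq_square algebra_simps)
    then show ?thesis by simp
  next
    case 2
    then have "x * y \<le> 0" by (simp add: mult_nonneg_nonpos)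
    moreover from this have "\<bar>x * x - x * (y * 2)\<bar> = x * x - x * (y * 2)"
      using zero_le_square[of x] by (intro abs_of_nonneg) linarith
    ultimately show ?thesis using 2 by (simp add: max_def power2_eq_square algebra_simps)
  next
    case 3
    then have "x * y \<le> 0" by (simp add: mult_nonpos_nonneg)
    then show ?thesis using 3 by (simp add: max_def power2_eq_square algebra_simps)
  qed simp
qed

lemma bump_second_difference_le:
  fixes t u :: "'a::real_inner"
  assumes R: "0 \<le> R" and u: "norm u \<le> 2"
  shows "\<bar>2 * bump R t - bump R (t - u) - bump R (t + u)\<bar>
           \<le> (2 * (2 * R + 6)\<^sup>2 + 4 * R\<^sup>2) * (norm u)\<^sup>2 * indicator (cball 0 (R + 2)) t"
proof (cases "norm t \<le> R + 2")
  case False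
  then have "R < norm t" "R < norm (t - u)" "R < norm (t + u)"
    using u norm_triangle_ineq2[of t u] norm_triangle_ineq2[of t "-u"] by auto
  then show ?thesis using R by (simp add: bump_eq_0)
next
  case True
  define q where "q = R\<^sup>2 - t \<bullet> t"
  define q1 where "q1 = R\<^sup>2 - (t - u) \<bullet> (t - u)"
  define q2 where "q2 = R\<^sup>2 - (t + u) \<bullet> (t + u)"
  have d: "q1 - q = 2 * (t \<bullet> u) - u \<bullet> u" "q2 - q = - 2 * (t \<bullet> u) - u \<bullet> u"
    by (simp_all add: q_def q1_def q2_def inner_diff inner_add inner_commute)
  have tu: "\<bar>t \<bullet> u\<bar> \<le> (R + 2) * norm u"
    using Cauchy_Schwarz_ineq2[of t u] True by (meson mult_right_mono norm_ge_zero order.trans)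
  have uu: "0 \<le> u \<bullet> u" "u \<bullet> u \<le> 2 * norm u"
    using u by (simp_all add: power2_norm_eq_inner[symmetric] power2_eq_square mult_right_mono)
  have "\<bar>q1 - q\<bar> \<le> (2 * R + 6) * norm u" "\<bar>q2 - q\<bar> \<le> (2 * R + 6) * norm u"
  proof -
    have "(2 * R + 6) * norm u = 2 * ((R + 2) * norm u) + 2 * norm u" by (simp add: algebra_simps)
    with d tu uu show "\<bar>q1 - q\<bar> \<le> (2 * R + 6) * norm u" "\<bar>q2 - q\<bar> \<le> (2 * R + 6) * norm u"
      by linarith+
  qed
  from this[THEN power_mono[of _ _ 2]]
  have sq: "(q1 - q)\<^sup>2 \<le> (2 * R + 6)\<^sup>2 * (norm u)\<^sup>2" "(q2 - q)\<^sup>2 \<le> (2 * R + 6)\<^sup>2 * (norm u)\<^sup>2"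
    by (auto simp: power_mult_distrib)
  have M: "0 \<le> max 0 q" "max 0 q \<le> R\<^sup>2" by (auto simp: q_def)
  \<comment> \<open>The parts linear in \<open>u\<close> cancel between the two opposite shifts;
    only a term quadratic in \<open>u\<close> is left of the first-order contributions.\<close>
  have "2 * max 0 q * (q1 - q) + 2 * max 0 q * (q2 - q) = - (4 * max 0 q * (norm u)\<^sup>2)"
    unfolding d power2_norm_eq_inner by (simp add: algebra_simps)
  then have lin: "2 * max 0 q * (q1 - q) = - (4 * max 0 q * (norm u)\<^sup>2) - 2 * max 0 q * (q2 - q)" by linarith
  have le: "4 * max 0 q * (norm u)\<^sup>2 \<le> 4 * R\<^sup>2 * (norm u)\<^sup>2" "0 \<le> 4 * max 0 q * (norm u)\<^sup>2"
    using M by (auto intro!: mult_right_mono)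
  have "\<bar>2 * Q - Q1 - Q2\<bar> \<le> 2 * K + J"
    if "\<bar>Q1 - Q - A\<bar> \<le> x" "\<bar>Q2 - Q - B\<bar> \<le> y" "x \<le> K" "y \<le> K" "A = - z - B" "z \<le> J" "0 \<le> z"
    for Q Q1 Q2 A B x y z K J :: real using that by linarith
  from this[OF pos_part_square_taylor[of q1 q] pos_part_square_taylor[of q2 q] sq lin le]
  have "\<bar>2 * (max 0 q)\<^sup>2 - (max 0 q1)\<^sup>2 - (max 0 q2)\<^sup>2\<bar>
     \<le> 2 * ((2 * R + 6)\<^sup>2 * (norm u)\<^sup>2) + 4 * R\<^sup>2 * (norm u)\<^sup>2" .
  also have "\<dots> = (2 * (2 * R + 6)\<^sup>2 + 4 * R\<^sup>2) * (norm u)\<^sup>2" by (simp add: algebra_simps)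
  finally show ?thesis using True unfolding bump_def q_def q1_def q2_def by simp
qed

section \<open>Integrals of the weight against functions of a linear form\<close>

lemma integrable_continuous_bounded_support:
  fixes f :: "'a::euclidean_space \<Rightarrow> real"
  assumes "continuous_on UNIV f" "\<And>t. r < norm t \<Longrightarrow> f t = 0"
  shows "integrable lborel f"
proof -
  have "integrable lborel (\<lambda>t. indicator (cball 0 r) t *\<^sub>R f t)"
    by (rule borel_integrable_compact) (auto intro: continuous_on_subset[OF assms(1)])
  also have "(\<lambda>t. indicator (cball 0 r) t *\<^sub>R f t) = f"
    using assms(2) by (auto simp: fun_eq_iff indicator_def not_le)
  finally show ?thesis .
qed

lemma integrable_bump_mult:
  fixes f :: "'a::euclidean_space \<Rightarrow> real"
  assumes "0 \<le> R" "continuous_on UNIV f"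
  shows "integrable lborel (\<lambda>t. bump R (t + u) * f t)"
proof (rule integrable_continuous_bounded_support)
  show "continuous_on UNIV (\<lambda>t. bump R (t + u) * f t)"
    by (intro continuous_intros assms)
  show "bump R (t + u) * f t = 0" if "R + norm u < norm t" for t
    using that norm_triangle_ineq2[of t "- u"] assms by (simp add: bump_eq_0)
qed

lemma lborel_integral_translation:
  fixes f :: "'a::euclidean_space \<Rightarrow> real"
  assumes "f \<in> borel_measurable borel"
  shows "(\<integral>t. f (u + t) \<partial>lborel) = (\<integral>t. f t \<partial>lborel)"
  using integral_distr[of "(+) u" lborel borel f] assms by (simp add: lborel_distr_plus)

text \<open>Moving the second difference from the tent to the bump along \<open>v\<close> gains the factor
  \<open>(m / \<bar>L v\<bar>)\<^sup>2\<close>; the third one comes from the measure of the strip.\<close>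

lemma integral_bump_tent_diff_le:
  fixes R :: real
  assumes R: "0 \<le> R"
  obtains C where "0 < C"
    "\<And>(L :: 'a::euclidean_space \<Rightarrow> real) v m. linear L \<Longrightarrow> norm v \<le> 2 \<Longrightarrow> L v \<noteq> 0 \<Longrightarrow> 0 < m \<Longrightarrow>
       \<bar>\<integral>t. bump R t * tent_diff m (L t) \<partial>lborel\<bar> \<le> C * m * min 1 ((m / \<bar>L v\<bar>)^3)"
proof -
  obtain C1 where C1: "0 < C1"
    "\<And>(L :: 'a \<Rightarrow> real) v h. linear L \<Longrightarrow> norm v \<le> 2 \<Longrightarrow> L v \<noteq> 0 \<Longrightarrow> 0 < h \<Longrightarrow>
       measure lebesgue {t \<in> cball 0 (R + 2). \<bar>L t\<bar> \<le> h} \<le> C1 * (h / \<bar>L v\<bar>)"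
    by (rule strip_measure_le[of "R + 2"]) blast
  define C2 where "C2 = 2 * (2 * R + 6)\<^sup>2 + 4 * R\<^sup>2"
  define B where "B = (\<integral>t. bump R (t::'a) \<partial>lborel)"
  have C2: "0 \<le> C2" by (simp add: C2_def)
  have B: "0 \<le> B" unfolding B_def by (simp add: bump_nonneg)
  define C where "C = 2 * B + 4 * C2 * C1 + 1"
  show thesis
  proof
    show "0 < C" using B C2 C1 by (simp add: C_def add_nonneg_pos)
    fix L :: "'a \<Rightarrow> real" and v and m :: real
    assume L: "linear L" and v: "norm v \<le> 2" "L v \<noteq> 0" and m: "0 < m"
    have contL: "continuous_on S L" for S
      by (intro linear_continuous_on linear_conv_bounded_linear[THEN iffD1] L)
    define I where "I = (\<integral>t. bump R t * tent_diff m (L t) \<partial>lborel)"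
    have int: "integrable lborel (\<lambda>t. bump R (t + u) * f t)" if "continuous_on UNIV f" for u and f :: "'a \<Rightarrow> real"
      by (rule integrable_bump_mult[OF R that])
    note int0 = int[where u = 0, simplified]
    have cont: "continuous_on UNIV (\<lambda>t. tent m (L t + x))" for x
      by (intro continuous_intros contL)
    have triv: "\<bar>I\<bar> \<le> 2 * B * m"
    proof -
      have "\<bar>I\<bar> \<le> (\<integral>t. \<bar>bump R t * tent_diff m (L t)\<bar> \<partial>lborel)"
        unfolding I_def by (rule integral_abs_bound)
      also have "\<dots> \<le> (\<integral>t. bump R (t::'a) * (2 * m) \<partial>lborel)"
      proof (rule Bochner_Integration.integral_mono)
        show "integrable lborel (\<lambda>t. \<bar>bump R t * tent_diff m (L t)\<bar>)"
          by (intro integrable_abs int0 continuous_intros contL)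
        show "integrable lborel (\<lambda>t::'a. bump R t * (2 * m))"
          by (intro int0 continuous_intros)
        show "\<bar>bump R t * tent_diff m (L t)\<bar> \<le> bump R t * (2 * m)" for t
          using abs_tent_diff_le[of m "L t"] m by (simp add: abs_mult bump_nonneg mult_left_mono)
      qed
      also have "\<dots> = 2 * B * m" by (simp add: B_def)
      finally show ?thesis .
    qed
    define s where "s = m / \<bar>L v\<bar>"
    have s: "0 < s" using m v by (simp add: s_def)
    have "\<bar>I\<bar> \<le> 4 * C2 * C1 * m * s ^ 3" if "s \<le> 1"
    proof -
      \<comment> \<open>Scaled so that \<open>L u = m\<close>: translating \<open>t\<close> by
        \<open>u\<close> moves the argument of the tent by exactly \<open>m\<close>. The assumption
        \<open>s \<le> 1\<close> keeps \<open>u\<close> within norm 2.\<close>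
      define u where "u = (m / L v) *\<^sub>R v"
      have Lu: "L u = m" using v by (simp add: u_def linear_cmul[OF L])
      have "norm u = s * norm v" using m by (simp add: u_def s_def)
      also have "\<dots> \<le> s * 2" using v s by (intro mult_left_mono) auto
      finally have nu: "norm u \<le> 2 * s" by simp
      then have nu2: "norm u \<le> 2" using that by linarith
      have meas: "(\<lambda>t. bump R (t + w) * tent m (L t)) \<in> borel_measurable borel" for w
        by (intro borel_measurable_continuous_onI continuous_intros contL)
      have sh1: "(\<integral>t. bump R t * tent m (L t + m) \<partial>lborel) = (\<integral>t. bump R (t - u) * tent m (L t) \<partial>lborel)"
        using lborel_integral_translation[OF meas[of "- u"], of u]
        by (simp add: linear_add[OF L] Lu add.commute)
      have sh2: "(\<integral>t. bump R t * tent m (L t - m) \<partial>lborel) = (\<integral>t. bump R (t + u) * tent m (L t) \<partial>lborel)"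
        using lborel_integral_translation[OF meas[of "u"], of "- u"]
        by (simp add: linear_diff[OF L] Lu)
      note i1 = int0[OF cont[of 0], simplified] and i2 = int0[OF cont[of m]]
        and i3 = int0[OF cont[of "- m"], simplified] and j1 = int[OF cont[of 0], of "- u", simplified]
        and j2 = int[OF cont[of 0], of "u", simplified]
      have "I = (\<integral>t. 2 * (bump R t * tent m (L t)) - bump R t * tent m (L t + m) - bump R t * tent m (L t - m) \<partial>lborel)"
        unfolding I_def tent_diff_def by (simp add: algebra_simps)
      also have "\<dots> = (\<integral>t. 2 * (bump R t * tent m (L t)) \<partial>lborel) - (\<integral>t. bump R (t - u) * tent m (L t) \<partial>lborel)
          - (\<integral>t. bump R (t + u) * tent m (L t) \<partial>lborel)"
        using i1 i2 i3 unfolding sh1[symmetric] sh2[symmetric] by simp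
      also have "\<dots> = (\<integral>t. 2 * (bump R t * tent m (L t)) - bump R (t - u) * tent m (L t) - bump R (t + u) * tent m (L t) \<partial>lborel)"
        using i1 j1 j2 by simp
      finally have I: "I = (\<integral>t. (2 * bump R t - bump R (t - u) - bump R (t + u)) * tent m (L t) \<partial>lborel)"
        by (simp add: algebra_simps)
      \<comment> \<open>The remaining integrand vanishes off this strip, whose measure is at most
        \<open>C1 * s\<close>: the third factor of \<open>s\<close>.\<close>
      define T where "T = {t \<in> cball 0 (R + 2). \<bar>L t\<bar> \<le> m}"
      have T: "T \<in> lmeasurable" unfolding T_def by (rule strip_lmeasurable[OF L])
      have "closed {t. \<bar>L t\<bar> \<le> m}"
        by (intro closed_Collect_le continuous_intros contL)
      then have "compact (cball 0 (R + 2) \<inter> {t. \<bar>L t\<bar> \<le> m})"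
        by (intro compact_Int_closed compact_cball)
      moreover have "cball 0 (R + 2) \<inter> {t. \<bar>L t\<bar> \<le> m} = T" by (auto simp: T_def)
      ultimately have Tc: "compact T" by simp
      then have Tb: "T \<in> sets borel" by (simp add: compact_imp_closed)
      have "\<bar>I\<bar> \<le> (\<integral>t. \<bar>(2 * bump R t - bump R (t - u) - bump R (t + u)) * tent m (L t)\<bar> \<partial>lborel)"
        unfolding I by (rule integral_abs_bound)
      also have "\<dots> \<le> (\<integral>t. C2 * (2 * s)\<^sup>2 * m * indicat_real T t \<partial>lborel)"
      proof (rule Bochner_Integration.integral_mono)
        have "integrable lborel (\<lambda>t. 2 * (bump R t * tent m (L t)) - bump R (t - u) * tent m (L t) - bump R (t + u) * tent m (L t))"
          using i1 j1 j2 by simp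
        then show "integrable lborel (\<lambda>t. \<bar>(2 * bump R t - bump R (t - u) - bump R (t + u)) * tent m (L t)\<bar>)"
          by (intro integrable_abs) (simp add: algebra_simps)
        have "emeasure lborel T < \<infinity>" by (rule emeasure_compact_finite[OF Tc])
        then show "integrable lborel (\<lambda>t. C2 * (2 * s)\<^sup>2 * m * indicat_real T t)"
          using Tb by simp
        fix t
        have "\<bar>2 * bump R t - bump R (t - u) - bump R (t + u)\<bar> * tent m (L t)
          \<le> (C2 * (norm u)\<^sup>2 * indicator (cball 0 (R + 2)) t) * (m * indicator {t. \<bar>L t\<bar> \<le> m} t)"
          using bump_second_difference_le[OF R nu2, of t] m C2
          by (intro mult_mono) (auto simp: C2_def tent_def indicator_def)
        also have "\<dots> \<le> (C2 * (2 * s)\<^sup>2 * indicator (cball 0 (R + 2)) t) * (m * indicator {t. \<bar>L t\<bar> \<le> m} t)"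
          using nu C2 m by (intro mult_right_mono mult_left_mono power_mono) auto
        also have "\<dots> = C2 * (2 * s)\<^sup>2 * m * indicat_real T t"
          by (simp add: T_def indicator_def)
        finally show "\<bar>(2 * bump R t - bump R (t - u) - bump R (t + u)) * tent m (L t)\<bar>
            \<le> C2 * (2 * s)\<^sup>2 * m * indicat_real T t"
          by (simp add: abs_mult tent_nonneg)
      qed
      also have "\<dots> = C2 * (2 * s)\<^sup>2 * m * measure lebesgue T"
        using Tb by simp
      also have "\<dots> \<le> C2 * (2 * s)\<^sup>2 * m * (C1 * s)"
        using C1(2)[OF L v m] C2 m unfolding T_def s_def by (intro mult_left_mono) auto
      also have "\<dots> = 4 * C2 * C1 * m * s ^ 3" by (simp add: power2_eq_square power3_eq_cube)
      finally show ?thesis .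
    qed
    have BC: "2 * B \<le> C" "4 * C2 * C1 \<le> C"
      using B C1 C2 unfolding C_def by simp_all
    have "2 * B * m \<le> C * m"
      using BC m by (intro mult_right_mono) auto
    with triv have le1: "\<bar>I\<bar> \<le> C * m" by linarith
    have le2: "\<bar>I\<bar> \<le> C * m * s ^ 3"
    proof (cases "s \<le> 1")
      case True
      have "4 * C2 * C1 * (m * s ^ 3) \<le> C * (m * s ^ 3)"
        using BC m s by (intro mult_right_mono) auto
      with \<open>s \<le> 1 \<Longrightarrow> \<bar>I\<bar> \<le> 4 * C2 * C1 * m * s ^ 3\<close>[OF True] show ?thesis by (simp add: mult.assoc)
    next
      case False
      then have "C * m * 1 \<le> C * m * s ^ 3"
        using \<open>0 < C\<close> m by (intro mult_left_mono one_le_power) auto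
      with le1 show ?thesis by simp
    qed
    have "\<bar>I\<bar> \<le> C * m * min 1 (s ^ 3)"
      using le1 le2 by (cases "1 \<le> s ^ 3") (simp_all add: min_def)
    then show "\<bar>\<integral>t. bump R t * tent_diff m (L t) \<partial>lborel\<bar> \<le> C * m * min 1 ((m / \<bar>L v\<bar>)^3)"
      unfolding I_def s_def .
  qed
qed

section \<open>Attractors\<close>

text \<open>Take a point of \<open>Y\<close> at the largest distance from \<open>X\<close>. It is
  the image of a point of \<open>Y\<close>, so that distance is at most \<open>q\<close> times
  itself, hence 0. Exchanging the roles of the two sets gives equality.\<close>

lemma attractor_unique:
  fixes f :: "'i::finite \<Rightarrow> 'a::heine_borel \<Rightarrow> 'a"
  assumes q: "q < 1" and f: "\<And>i x y. dist (f i x) (f i y) \<le> q * dist x y"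
    and X: "X \<noteq> {}" "compact X" "X = (\<Union>i. f i ` X)"
    and Y: "compact Y" "Y = (\<Union>i. f i ` Y)"
  shows "Y \<subseteq> X"
proof (cases "Y = {}")
  case False
  have cont: "continuous_on Y (\<lambda>y. infdist y X)" by (intro continuous_intros)
  obtain y where y: "y \<in> Y" "\<And>z. z \<in> Y \<Longrightarrow> infdist z X \<le> infdist y X"
    using continuous_attains_sup[OF Y(1) False cont] by blast
  obtain i z where z: "z \<in> Y" "y = f i z" using y(1) Y(2) by blast
  obtain x where x: "x \<in> X" "infdist z X = dist z x"
    using infdist_attains_inf[OF compact_imp_closed[OF X(2)] X(1)] by blast
  have fx: "f i x \<in> X" using X(3) x(1) by blast
  have "infdist y X \<le> dist (f i z) (f i x)" unfolding z(2) by (rule infdist_le[OF fx])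
  also have "\<dots> \<le> q * dist z x" by (rule f)
  finally have *: "infdist y X \<le> q * infdist z X" by (simp add: x(2))
  have "infdist y X \<le> 0"
  proof (rule ccontr)
    assume pos: "\<not> infdist y X \<le> 0"
    have "q * infdist z X < infdist y X"
    proof (cases "0 < q")
      case True
      then have "q * infdist z X \<le> q * infdist y X" using y(2)[OF z(1)] by simp
      also have "\<dots> < 1 * infdist y X" using q pos by (intro mult_strict_right_mono) auto
      finally show ?thesis by simp
    next
      case False
      then have "q * infdist z X \<le> 0" by (simp add: mult_nonpos_nonneg infdist_nonneg)
      then show ?thesis using pos by linarith
    qed
    with * show False by simp
  qed
  then have "infdist z X = 0" if "z \<in> Y" for z
    using y(2)[OF that] infdist_nonneg[of z X] by linarith
  then show ?thesis
    using in_closed_iff_infdist_zero[OF compact_imp_closed[OF X(2)] X(1)] by blast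
qed simp

text \<open>Iterated images of a ball that is mapped into itself decrease, and their intersection is
  the fixed set; no metric on the space of compact sets enters.\<close>

lemma attractor_exists:
  fixes f :: "'i::finite \<Rightarrow> 'a::heine_borel \<Rightarrow> 'a"
  assumes q: "0 \<le> q" "q < 1" and f: "\<And>i x y. dist (f i x) (f i y) \<le> q * dist x y"
  shows "\<exists>X. X \<noteq> {} \<and> compact X \<and> X = (\<Union>i. f i ` X)"
proof -
  define x0 :: 'a where "x0 = undefined"
  define M where "M = Max (range (\<lambda>i. dist x0 (f i x0)))"
  \<comment> \<open>\<open>R\<close> solves \<open>M + q * R = R\<close>, so the ball of this radius
    around \<open>x0\<close> is mapped into itself.\<close>
  define R where "R = M / (1 - q)"
  have M: "dist x0 (f i x0) \<le> M" for i unfolding M_def by (intro Max_ge) auto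
  have R: "M + q * R = R" using q unfolding R_def by (simp add: field_simps)
  have "0 \<le> M" using M[of undefined] zero_le_dist order.trans by blast
  then have R0: "0 \<le> R" using q by (simp add: R_def)
  define F where "F S = (\<Union>i. f i ` S)" for S :: "'a set"
  define K where "K n = (F ^^ n) (cball x0 R)" for n
  have K0: "K 0 = cball x0 R" and KS: "K (Suc n) = (\<Union>i. f i ` K n)" for n
    by (simp_all add: K_def F_def)
  have contf: "continuous_on S (f i)" for i S
  proof (rule continuous_onI)
    fix x e assume "x \<in> S" "(0::real) < e"
    have "dist (f i y) (f i x) \<le> e" if "dist y x < e" for y
      using f[of i y x] q mult_right_mono[of q 1 "dist y x"] that by simp
    then show "\<exists>d>0. \<forall>y\<in>S. dist y x < d \<longrightarrow> dist (f i y) (f i x) \<le> e"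
      using \<open>0 < e\<close> by blast
  qed
  have compact: "compact (K n)" for n
    by (induction n) (auto simp: K0 KS intro!: compact_UN compact_continuous_image contf)
  have ne: "K n \<noteq> {}" for n
    using R0 by (induction n) (auto simp: K0 KS)
  have step: "K (Suc n) \<subseteq> K n" for n
  proof (induction n)
    case 0
    have "dist x0 (f i x) \<le> R" if "dist x0 x \<le> R" for i x
    proof -
      have "dist x0 (f i x) \<le> dist x0 (f i x0) + dist (f i x0) (f i x)" by (rule dist_triangle)
      also have "\<dots> \<le> M + q * dist x0 x" by (intro add_mono M f)
      also have "\<dots> \<le> M + q * R" using that q by (simp add: mult_left_mono)
      finally show ?thesis by (simp add: R)
    qed
    then show ?case by (auto simp: K0 KS)
  next
    case (Suc n)
    then show ?case by (subst (1 2) KS) blast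
  qed
  then have anti: "K n \<subseteq> K m" if "m \<le> n" for m n
    by (rule lift_Suc_antimono_le[OF _ that])
  define X where "X = (\<Inter>n. K n)"
  have "X \<noteq> {}"
    unfolding X_def by (rule compact_nest) (use compact ne anti in auto)
  moreover have "compact X"
    unfolding X_def by (rule compact_Inter) (use compact in auto)
  moreover have "(\<Union>i. f i ` X) \<subseteq> X"
  proof clarsimp
    fix i x assume x: "x \<in> X"
    have "f i x \<in> K (Suc n)" for n using x unfolding KS X_def by blast
    then show "f i x \<in> X" using step unfolding X_def by blast
  qed
  moreover have "X \<subseteq> (\<Union>i. f i ` X)"
  proof
    fix x assume x: "x \<in> X"
    \<comment> \<open>The map through which \<open>x\<close> comes from \<open>K n\<close> may vary
      with \<open>n\<close>. One map serves infinitely many \<open>n\<close>, hence all by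
      monotonicity, and compactness then yields a preimage in every \<open>K m\<close> at
      once.\<close>
    have "\<exists>i. x \<in> f i ` K n" for n
      using x KS[of n] unfolding X_def by blast
    then obtain \<iota> where \<iota>: "\<And>n. x \<in> f (\<iota> n) ` K n" by metis
    obtain i where "infinite {n. \<iota> n = i}"
      using pigeonhole_infinite[of "UNIV :: nat set" \<iota>] by auto
    then have inf: "\<exists>n\<ge>m. \<iota> n = i" for m
      by (metis (mono_tags, lifting) finite_nat_set_iff_bounded mem_Collect_eq not_le)
    have "f i -` {x} \<inter> K m \<noteq> {}" for m
    proof -
      obtain n where "m \<le> n" "\<iota> n = i" using inf by blast
      then show ?thesis using \<iota>[of n] anti[of m n] by blast
    qed
    moreover have "closed (f i -` {x})"
      using continuous_closed_vimage[of "{x}" "f i"] contf[of UNIV i]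
      by (simp add: continuous_on_eq_continuous_at)
    then have "compact (f i -` {x} \<inter> K m)" for m
      using compact by (simp add: closed_Int_compact)
    ultimately have "(\<Inter>m. f i -` {x} \<inter> K m) \<noteq> {}"
      by (intro compact_nest) (use anti in blast)+
    then show "x \<in> (\<Union>i. f i ` X)" unfolding X_def by blast
  qed
  ultimately show ?thesis by blast
qed

lemma attractor_properties:
  fixes f :: "'i::finite \<Rightarrow> 'a::heine_borel \<Rightarrow> 'a"
  assumes q: "0 \<le> q" "q < 1" and f: "\<And>i x y. dist (f i x) (f i y) \<le> q * dist x y"
  shows "attractor f \<noteq> {}" "compact (attractor f)" "attractor f = (\<Union>i. f i ` attractor f)"
proof -
  have "\<exists>!X. X \<noteq> {} \<and> compact X \<and> X = (\<Union>i. f i ` X)"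
  proof (rule ex_ex1I[OF attractor_exists[OF q f]], elim conjE)
    fix X Y
    assume X: "X \<noteq> {}" "compact X" "X = (\<Union>i. f i ` X)" and Y: "Y \<noteq> {}" "compact Y" "Y = (\<Union>i. f i ` Y)"
    show "X = Y"
      by (rule subset_antisym attractor_unique[OF q(2) f Y X(2,3)] attractor_unique[OF q(2) f X Y(2,3)])+
  qed
  then have *: "attractor f \<noteq> {} \<and> compact (attractor f) \<and> attractor f = (\<Union>i. f i ` attractor f)"
    unfolding attractor_def by (rule theI')
  show "attractor f \<noteq> {}" by (rule *[THEN conjunct1])
  show "compact (attractor f)" by (rule *[THEN conjunct2, THEN conjunct1])
  show "attractor f = (\<Union>i. f i ` attractor f)" by (rule *[THEN conjunct2, THEN conjunct2])
qed

section \<open>Cylinder positions as functions of the translations\<close>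

primrec pt :: "('i \<Rightarrow> real) \<Rightarrow> ('i \<Rightarrow> real) \<Rightarrow> 'i list \<Rightarrow> real" where
  "pt r u [] = 0"
| "pt r u (i # w) = u i + r i * pt r u w"

lemma pt_append: "pt r u (v @ w) = pt r u v + wprod r v * pt r u w"
  by (induction v) (auto simp: algebra_simps)

lemma abs_pt_le:
  assumes u: "\<And>i. \<bar>u i\<bar> \<le> B" and r: "\<And>i. \<bar>r i\<bar> \<le> q" and q: "q < 1"
  shows "\<bar>pt r u w\<bar> \<le> B / (1 - q)"
proof (induction w)
  case Nil
  have "0 \<le> B" using u[of undefined] by linarith
  then show ?case using q by simp
next
  case (Cons i w)
  have q0: "0 \<le> q" using r[of undefined] by linarith
  have "\<bar>pt r u (i # w)\<bar> \<le> \<bar>u i\<bar> + \<bar>r i\<bar> * \<bar>pt r u w\<bar>"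
    by (simp add: abs_mult[symmetric] abs_triangle_ineq)
  also have "\<dots> \<le> B + q * (B / (1 - q))"
    by (intro add_mono mult_mono u r Cons.IH q0) auto
  also have "\<dots> = B / (1 - q)" using q by (simp add: field_simps)
  finally show ?case .
qed

text \<open>With the ratios fixed, each coordinate of the image of the origin under a word is a
  linear form in the translations. Differences of positions are therefore forms to which the strip
  and bump estimates apply.\<close>

lemma linear_pt: "linear (\<lambda>t :: real ^ 2 ^ 'i. pt r (\<lambda>i. t $ i $ b) w)"
  by (rule linearI; induction w) (auto simp: algebra_simps)

text \<open>Moving the two letters in opposite directions gives their difference a head start of 2.
  With a head start of 1, from moving \<open>i\<close> alone, the tail bound
  \<open>1 / (1 - q)\<close> would only allow ratios below 1/3 instead of 1/2.\<close>

definition swap_dir :: "2 \<Rightarrow> 'i \<Rightarrow> 'i \<Rightarrow> real ^ 2 ^ 'i::finite" where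
  "swap_dir b i j = axis i (axis b 1) - axis j (axis b 1)"

lemma norm_swap_dir_le: "norm (swap_dir b i j :: real ^ 2 ^ 'i::finite) \<le> 2"
proof -
  have "norm (axis k (axis b (1::real)) :: real ^ 2 ^ 'i) = 1" for k
    by (simp add: norm_eq_sqrt_inner inner_axis_axis)
  then show ?thesis
    unfolding swap_dir_def using norm_triangle_ineq4[of "axis i (axis b (1::real))" "axis j (axis b 1)"]
    by simp
qed

text \<open>The contractions being less than 1/2 keeps the later letters from cancelling the contribution
  of the first letters.\<close>

lemma transversality:
  assumes r: "\<And>i. \<bar>r i\<bar> \<le> q" and q: "q < 1/2" and ij: "i \<noteq> j"
  shows "2 * (1 - 2 * q) \<le> pt r (\<lambda>k. swap_dir b i j $ k $ b) (i # v) - pt r (\<lambda>k. swap_dir b i j $ k $ b) (j # w)"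
proof -
  define u where "u k = swap_dir b i j $ k $ b" for k
  have q0: "0 \<le> q" using r[of undefined] by linarith
  have u: "u i = 1" "u j = -1" "\<bar>u k\<bar> \<le> 1" for k
    using ij by (auto simp: u_def swap_dir_def axis_def)
  have "\<bar>r k * pt r u x\<bar> \<le> 2 * q" for k x
  proof -
    have "\<bar>pt r u x\<bar> \<le> 1 / (1 - q)" by (rule abs_pt_le[OF u(3) r]) (use q in auto)
    also have "\<dots> \<le> 2" using q by (simp add: field_simps)
    finally have "\<bar>r k * pt r u x\<bar> \<le> q * 2"
      unfolding abs_mult by (intro mult_mono r) (use q0 in auto)
    then show ?thesis by simp
  qed
  from this[of i v] this[of j w] show ?thesis
    unfolding u_def[symmetric] by (simp add: u abs_le_iff)
qed

primrec fw :: "('i \<Rightarrow> 'a \<Rightarrow> 'a) \<Rightarrow> 'i list \<Rightarrow> 'a \<Rightarrow> 'a" where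
  "fw f [] x = x"
| "fw f (i # w) x = f i (fw f w x)"

lemma diag_affine_component [simp]:
  "diag_affine a c t i x $ 1 = t $ i $ 1 + a i * x $ 1"
  "diag_affine a c t i x $ 2 = t $ i $ 2 + c i * x $ 2"
  by (simp_all add: diag_affine_def matrix_vector_mult_def sum_2)

lemma fw_diag_affine:
  "fw (diag_affine a c t) w x $ 1 = pt a (\<lambda>i. t $ i $ 1) w + wprod a w * x $ 1"
  "fw (diag_affine a c t) w x $ 2 = pt c (\<lambda>i. t $ i $ 2) w + wprod c w * x $ 2"
  by (induction w) (auto simp: algebra_simps)

lemma fw_cover:
  fixes X :: "'a set" and f :: "'i::finite \<Rightarrow> 'a \<Rightarrow> 'a"
  assumes "X = (\<Union>i. f i ` X)"
  shows "X = (\<Union>w\<in>words n. fw f w ` X)"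
proof (induction n)
  case (Suc n)
  have "(\<Union>w\<in>words (Suc n). fw f w ` X) = (\<Union>i. f i ` (\<Union>w\<in>words n. fw f w ` X))"
    by (fastforce simp: words_def length_Suc_conv image_iff)
  then show ?case using Suc assms by simp
qed simp

section \<open>The standing hypotheses and the size of the attractor\<close>

locale diag_ifs =
  fixes a c :: "'i::finite \<Rightarrow> real" and s :: real
  assumes ac: "0 < \<bar>a i\<bar>" "\<bar>a i\<bar> < \<bar>c i\<bar>" "\<bar>c i\<bar> < 1/2"
    and large: "(\<Sum>i\<in>UNIV. \<bar>c i\<bar> * \<bar>a i\<bar> powr (1/4)) > 1"
    and small: "(\<Sum>i\<in>UNIV. \<bar>a i\<bar> powr (1/2)) < 1"
    and dim: "(\<Sum>i\<in>UNIV. \<bar>c i\<bar> * \<bar>a i\<bar> powr (s - 1)) = 1"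
begin

definition q where "q = Max (range (\<lambda>i. \<bar>c i\<bar>))"

lemma c_le_q: "\<bar>c i\<bar> \<le> q" and q_less: "q < 1/2" and q_pos: "0 < q"
proof -
  show *: "\<bar>c i\<bar> \<le> q" for i unfolding q_def by (intro Max_ge) auto
  show "q < 1/2" unfolding q_def using ac by (subst Max_less_iff) auto
  show "0 < q" using *[of undefined] ac[of undefined] by linarith
qed

lemma a_le_q: "\<bar>a i\<bar> \<le> q" using c_le_q[of i] ac[of i] by linarith

abbreviation A :: "real ^ 2 ^ 'i \<Rightarrow> (real ^ 2) set" where
  "A t \<equiv> attractor (diag_affine a c t)"

lemma diag_affine_contraction: "dist (diag_affine a c t i x) (diag_affine a c t i y) \<le> q * dist x y"
proof -
  have "norm ((diag_affine a c t i x - diag_affine a c t i y) $ b) \<le> norm ((q *\<^sub>R (x - y)) $ b)" for b :: 2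
    using exhaust_2[of b] a_le_q[of i] c_le_q[of i] q_pos
    by (auto simp: right_diff_distrib[symmetric] abs_mult mult_right_mono)
  then have "norm (diag_affine a c t i x - diag_affine a c t i y) \<le> norm (q *\<^sub>R (x - y))"
    by (rule norm_le_componentwise_cart)
  then show ?thesis using q_pos by (simp add: dist_norm)
qed

lemma A_ne: "A t \<noteq> {}" and A_compact: "compact (A t)" and A_eq: "A t = (\<Union>i. diag_affine a c t i ` A t)"
  using attractor_properties[OF _ _ diag_affine_contraction[of t]] q_pos q_less by fastforce+

text \<open>At a point of the attractor where the coordinate is largest in absolute value, the
  contraction by at most 1/2 gives \<open>|x $ b| \<le> norm t + |x $ b| / 2\<close>.\<close>

lemma A_component_bound: "x \<in> A t \<Longrightarrow> \<bar>x $ b\<bar> \<le> 2 * norm t"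
proof -
  have "continuous_on (A t) (\<lambda>x. \<bar>x $ b\<bar>)" by (intro continuous_intros)
  then obtain x where x: "x \<in> A t" "\<And>y. y \<in> A t \<Longrightarrow> \<bar>y $ b\<bar> \<le> \<bar>x $ b\<bar>"
    using continuous_attains_sup[OF A_compact A_ne] by blast
  then obtain i y where y: "y \<in> A t" "x = diag_affine a c t i y" using A_eq[of t] by blast
  have "\<bar>t $ i $ b\<bar> \<le> norm t"
    using Finite_Cartesian_Product.norm_nth_le[of "t $ i" b] Finite_Cartesian_Product.norm_nth_le[of t i] by simp
  moreover have "\<bar>x $ b\<bar> \<le> \<bar>t $ i $ b\<bar> + 1/2 * \<bar>y $ b\<bar>"
  proof -
    have "\<bar>a i\<bar> * \<bar>y $ b\<bar> \<le> 1/2 * \<bar>y $ b\<bar>" "\<bar>c i\<bar> * \<bar>y $ b\<bar> \<le> 1/2 * \<bar>y $ b\<bar>"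
      using ac[of i] by (intro mult_right_mono; linarith)+
    moreover have "\<bar>x $ b\<bar> \<le> \<bar>t $ i $ b\<bar> + \<bar>a i\<bar> * \<bar>y $ b\<bar> \<or> \<bar>x $ b\<bar> \<le> \<bar>t $ i $ b\<bar> + \<bar>c i\<bar> * \<bar>y $ b\<bar>"
      using exhaust_2[of b] by (auto simp: y(2) abs_mult[symmetric] abs_triangle_ineq)
    ultimately show ?thesis by linarith
  qed
  ultimately have "\<bar>x $ b\<bar> \<le> 2 * norm t" using x(2)[OF y(1)] by linarith
  then show "\<bar>x $ b\<bar> \<le> 2 * norm t" if "x \<in> A t" for x using x(2)[OF that] by linarith
qed

end

section \<open>Separation of the horizontal projection\<close>

lemma fw_append: "fw f (u @ v) x = fw f u (fw f v x)"
  by (induction u) auto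

context diag_ifs
begin

definition overlap :: "real ^ 2 ^ 'i \<Rightarrow> 'i list \<Rightarrow> 'i list \<Rightarrow> bool" where
  "overlap t I J \<longleftrightarrow> (\<exists>x\<in>A t. \<exists>y\<in>A t. fw (diag_affine a c t) I x $ 1 = fw (diag_affine a c t) J y $ 1)"

lemma overlap_sym: "overlap t I J \<longleftrightarrow> overlap t J I"
  unfolding overlap_def by metis

lemma overlap_step: "overlap t I J \<Longrightarrow> \<exists>k. overlap t (I @ [k]) J"
proof -
  assume "overlap t I J"
  then obtain x y where xy: "x \<in> A t" "y \<in> A t"
    "fw (diag_affine a c t) I x $ 1 = fw (diag_affine a c t) J y $ 1" by (auto simp: overlap_def)
  then obtain k x' where "x' \<in> A t" "x = diag_affine a c t k x'" using A_eq[of t] by blast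
  then show ?thesis using xy by (auto simp: overlap_def fw_append intro!: exI[of _ k])
qed

lemma overlap_imp_close:
  assumes "overlap t I J" "norm t \<le> R"
  shows "\<bar>pt a (\<lambda>i. t $ i $ 1) I - pt a (\<lambda>i. t $ i $ 1) J\<bar> \<le> 2 * R * (\<bar>wprod a I\<bar> + \<bar>wprod a J\<bar>)"
proof -
  obtain x y where x: "x \<in> A t" and y: "y \<in> A t"
    and eq: "fw (diag_affine a c t) I x $ 1 = fw (diag_affine a c t) J y $ 1"
    using assms by (auto simp: overlap_def)
  have "\<bar>wprod a w * z $ 1\<bar> \<le> 2 * R * \<bar>wprod a w\<bar>" if "z \<in> A t" for w z
  proof -
    have "\<bar>wprod a w\<bar> * \<bar>z $ 1\<bar> \<le> \<bar>wprod a w\<bar> * (2 * R)"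
      using A_component_bound[OF that, of 1] assms by (intro mult_left_mono) auto
    then show ?thesis by (simp add: abs_mult mult.commute)
  qed
  moreover have "\<bar>P - Q\<bar> \<le> U + V" if "P + X = Q + Y" "\<bar>X\<bar> \<le> U" "\<bar>Y\<bar> \<le> V" for P Q X Y U V :: real
    using that by linarith
  ultimately show ?thesis
    using eq x y unfolding fw_diag_affine distrib_left by blast
qed

lemma abs_wprod_a_pos: "0 < \<bar>wprod a w\<bar>" and abs_wprod_c_pos: "0 < \<bar>wprod c w\<bar>"
proof -
  have "0 < \<bar>c i\<bar>" for i using ac[of i] by linarith
  then show "0 < \<bar>wprod a w\<bar>" "0 < \<bar>wprod c w\<bar>"
    unfolding abs_wprod by (intro wprod_pos ac(1); simp)+
qed

text \<open>The number \<open>n\<close> is free: it counts subdivisions of the wider cylinder, each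
  of which keeps the widths comparable and multiplies the bound by the sum of the
  \<open>|a i| powr (1/2)\<close>. The geometric mean of the widths gains this factor whichever word
  is extended. Enclosing the overlap set in some \<open>T\<close> avoids proving it
  measurable.\<close>

lemma overlap_measure:
  assumes R: "0 < R"
  obtains C \<alpha> where "0 < C" "\<And>i. \<alpha> \<le> \<bar>a i\<bar>"
    "\<And>n i j I J. i \<noteq> j \<Longrightarrow> \<alpha> * \<bar>wprod a (i # I)\<bar> \<le> \<bar>wprod a (j # J)\<bar> \<Longrightarrow> \<alpha> * \<bar>wprod a (j # J)\<bar> \<le> \<bar>wprod a (i # I)\<bar> \<Longrightarrow>
      \<exists>T\<in>lmeasurable. {t \<in> cball 0 R. overlap t (i # I) (j # J)} \<subseteq> T \<and>
        measure lebesgue T \<le> C * (\<Sum>i\<in>UNIV. \<bar>a i\<bar> powr (1/2)) ^ n * sqrt (\<bar>wprod a (i # I)\<bar> * \<bar>wprod a (j # J)\<bar>)"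
proof -
  obtain C1 where C1: "0 < C1"
    "\<And>(L :: real ^ 2 ^ 'i \<Rightarrow> real) v h. linear L \<Longrightarrow> norm v \<le> 2 \<Longrightarrow> L v \<noteq> 0 \<Longrightarrow> 0 < h \<Longrightarrow>
       measure lebesgue {t \<in> cball 0 R. \<bar>L t\<bar> \<le> h} \<le> C1 * (h / \<bar>L v\<bar>)"
    by (rule strip_measure_le[of R]) blast
  define \<alpha> where "\<alpha> = Min (range (\<lambda>i. \<bar>a i\<bar>))"
  have \<alpha>: "\<alpha> \<le> \<bar>a i\<bar>" for i unfolding \<alpha>_def by (intro Min_le) auto
  have \<alpha>0: "0 < \<alpha>" unfolding \<alpha>_def using ac by (subst Min_gr_iff) auto
  define \<eta> where "\<eta> = 2 * (1 - 2 * q)"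
  have \<eta>: "0 < \<eta>" using q_less by (simp add: \<eta>_def)
  define \<theta> where "\<theta> = (\<Sum>i\<in>UNIV. \<bar>a i\<bar> powr (1/2))"
  have a1: "\<bar>a i\<bar> \<le> 1" for i using a_le_q[of i] q_less by linarith
  \<comment> \<open>Comparable widths satisfy
    \<open>x + y \<le> 2 / sqrt \<alpha> * sqrt (x * y)\<close>, and \<open>\<eta>\<close> bounds
    the linear form from below by transversality.\<close>
  define C where "C = C1 * (2 * R * (2 / sqrt \<alpha>) / \<eta>)"
  have C: "0 < C" using C1 R \<alpha>0 \<eta> by (simp add: C_def)
  have main: "\<exists>T\<in>lmeasurable. {t \<in> cball 0 R. overlap t (i # I) (j # J)} \<subseteq> T \<and>
        measure lebesgue T \<le> C * \<theta> ^ n * sqrt (\<bar>wprod a (i # I)\<bar> * \<bar>wprod a (j # J)\<bar>)"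
    if "i \<noteq> j" "\<alpha> * \<bar>wprod a (i # I)\<bar> \<le> \<bar>wprod a (j # J)\<bar>" "\<alpha> * \<bar>wprod a (j # J)\<bar> \<le> \<bar>wprod a (i # I)\<bar>" for n i j I J
    using that
  proof (induction n arbitrary: i j I J)
    case 0
    define x where "x = \<bar>wprod a (i # I)\<bar>"
    define y where "y = \<bar>wprod a (j # J)\<bar>"
    have xy: "0 < x" "0 < y" unfolding x_def y_def by (rule abs_wprod_a_pos)+
    define L where "L t = pt a (\<lambda>k. t $ k $ 1) (i # I) - pt a (\<lambda>k. t $ k $ 1) (j # J)" for t :: "real ^ 2 ^ 'i"
    have L: "linear L" unfolding L_def by (intro linear_compose_sub linear_pt)
    have Lv: "\<eta> \<le> L (swap_dir 1 i j)"
      unfolding L_def \<eta>_def by (rule transversality[where r = a, OF a_le_q q_less 0(1)])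
    have h: "0 < 2 * R * (x + y)" using R xy by simp
    let ?T = "{t \<in> cball 0 R. \<bar>L t\<bar> \<le> 2 * R * (x + y)}"
    have sub: "{t \<in> cball 0 R. overlap t (i # I) (j # J)} \<subseteq> ?T"
    proof
      fix t assume t: "t \<in> {t \<in> cball 0 R. overlap t (i # I) (j # J)}"
      then have "\<bar>L t\<bar> \<le> 2 * R * (x + y)"
        unfolding L_def x_def y_def by (intro overlap_imp_close) auto
      then show "t \<in> ?T" using t by simp
    qed
    have "measure lebesgue ?T \<le> C * sqrt (x * y)"
    proof -
      have "measure lebesgue ?T \<le> C1 * (2 * R * (x + y) / \<bar>L (swap_dir 1 i j)\<bar>)"
        by (rule C1(2)[OF L norm_swap_dir_le _ h]) (use Lv \<eta> in auto)
      also have "\<dots> \<le> C1 * (2 * R * (x + y) / \<eta>)"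
        using C1 h Lv \<eta> by (intro mult_left_mono divide_left_mono) auto
      also have "\<dots> \<le> C1 * (2 * R * (2 / sqrt \<alpha> * sqrt (x * y)) / \<eta>)"
      proof -
        have "z \<le> sqrt (x * y) / sqrt \<alpha>" if "0 < z" "\<alpha> * (z * z) \<le> x * y" for z
        proof -
          have "sqrt \<alpha> * z \<le> sqrt (x * y)"
            using real_sqrt_le_mono[OF that(2)] \<open>0 < z\<close> by (simp add: real_sqrt_mult)
          then show ?thesis using \<alpha>0 by (simp add: field_simps)
        qed
        note root = this
        have "\<alpha> * (x * x) \<le> x * y" "\<alpha> * (y * y) \<le> x * y"
          using mult_right_mono[OF 0(2), of x] mult_right_mono[OF 0(3), of y] xy
          unfolding x_def[symmetric] y_def[symmetric] by (auto simp: ac_simps)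
        then have "x + y \<le> sqrt (x * y) / sqrt \<alpha> + sqrt (x * y) / sqrt \<alpha>"
          using xy by (intro add_mono root)
        then have "x + y \<le> 2 / sqrt \<alpha> * sqrt (x * y)" by simp
        then show ?thesis using C1 R \<eta> by (intro mult_left_mono divide_right_mono) auto
      qed
      also have "\<dots> = C * sqrt (x * y)" by (simp add: C_def)
      finally show ?thesis .
    qed
    then have mT: "measure lebesgue ?T \<le> C * \<theta> ^ 0 * sqrt (\<bar>wprod a (i # I)\<bar> * \<bar>wprod a (j # J)\<bar>)"
      unfolding x_def y_def power_0 mult_1_right .
    show ?case by (intro bexI[OF _ strip_lmeasurable[OF L]] conjI) (rule sub, rule mT)
  next
    case (Suc n)
    have step: "\<exists>T\<in>lmeasurable. {t \<in> cball 0 R. overlap t (i # I) (j # J)} \<subseteq> T \<and>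
        measure lebesgue T \<le> C * \<theta> ^ Suc n * sqrt (\<bar>wprod a (i # I)\<bar> * \<bar>wprod a (j # J)\<bar>)"
      if ij: "i \<noteq> j" and le: "\<bar>wprod a (j # J)\<bar> \<le> \<bar>wprod a (i # I)\<bar>" and comp: "\<alpha> * \<bar>wprod a (i # I)\<bar> \<le> \<bar>wprod a (j # J)\<bar>"
      for i j I J
    proof -
      define x where "x = \<bar>wprod a (i # I)\<bar>"
      define y where "y = \<bar>wprod a (j # J)\<bar>"
      have xy: "0 < x" "0 < y" unfolding x_def y_def by (rule abs_wprod_a_pos)+
      have xk: "\<bar>wprod a (i # I @ [k])\<bar> = x * \<bar>a k\<bar>" for k by (simp add: x_def abs_mult)
      have "\<exists>T\<in>lmeasurable. {t \<in> cball 0 R. overlap t (i # I @ [k]) (j # J)} \<subseteq> T \<and>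
          measure lebesgue T \<le> C * \<theta> ^ n * sqrt (x * \<bar>a k\<bar> * y)" for k
      proof -
        have "\<alpha> * (x * \<bar>a k\<bar>) \<le> \<alpha> * (x * 1)"
          using \<alpha>0 xy a1 by (intro mult_left_mono) auto
        then have 1: "\<alpha> * (x * \<bar>a k\<bar>) \<le> y" using comp by (simp add: x_def y_def)
        \<comment> \<open>Here it matters that the wider word is the extended one: it shrinks by
          \<open>|a k|\<close>, which is at least \<open>\<alpha>\<close>.\<close>
        have "\<alpha> * y \<le> \<bar>a k\<bar> * x"
          using \<alpha> \<alpha>0 le xy unfolding x_def[symmetric] y_def[symmetric] by (intro mult_mono) auto
        then have 2: "\<alpha> * y \<le> x * \<bar>a k\<bar>" by (simp add: mult.commute)
        show ?thesis
          by (rule Suc.IH[OF ij, of "I @ [k]" J, unfolded xk y_def[symmetric], OF 1 2])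
      qed
      then have "\<forall>k. \<exists>T. T \<in> lmeasurable \<and> {t \<in> cball 0 R. overlap t (i # I @ [k]) (j # J)} \<subseteq> T \<and>
          measure lebesgue T \<le> C * \<theta> ^ n * sqrt (x * \<bar>a k\<bar> * y)"
        unfolding Bex_def by (rule allI)
      from choice[OF this] obtain T where T: "\<And>k. T k \<in> lmeasurable" "\<And>k. {t \<in> cball 0 R. overlap t (i # I @ [k]) (j # J)} \<subseteq> T k"
        "\<And>k. measure lebesgue (T k) \<le> C * \<theta> ^ n * sqrt (x * \<bar>a k\<bar> * y)" by blast
      have sub: "{t \<in> cball 0 R. overlap t (i # I) (j # J)} \<subseteq> (\<Union>k. T k)"
      proof
        fix t assume t: "t \<in> {t \<in> cball 0 R. overlap t (i # I) (j # J)}"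
        then obtain k where "overlap t (i # I @ [k]) (j # J)"
          using overlap_step[of t "i # I" "j # J"] by auto
        then have "t \<in> T k" using t T(2)[of k] by blast
        then show "t \<in> (\<Union>k. T k)" by blast
      qed
      have mT: "measure lebesgue (\<Union>k. T k) \<le> C * \<theta> ^ Suc n * sqrt (x * y)"
      proof -
        have "measure lebesgue (\<Union>k. T k) \<le> (\<Sum>k\<in>UNIV. measure lebesgue (T k))"
          by (rule measure_UNION_le) (use T in auto)
        also have "\<dots> \<le> (\<Sum>k\<in>UNIV. C * \<theta> ^ n * sqrt (x * \<bar>a k\<bar> * y))"
          by (intro sum_mono T)
        also have "\<dots> = (\<Sum>k\<in>UNIV. C * \<theta> ^ n * sqrt (x * y) * \<bar>a k\<bar> powr (1/2))"
          by (intro sum.cong refl) (simp add: real_sqrt_mult powr_half_sqrt)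
        also have "\<dots> = C * \<theta> ^ Suc n * sqrt (x * y)"
          by (simp add: sum_distrib_left[symmetric] \<theta>_def[symmetric])
        finally show ?thesis .
      qed
      have "(\<Union>k. T k) \<in> lmeasurable" by (intro fmeasurable.finite_UN T(1)) auto
      then show ?thesis
        by (intro bexI[where x = "\<Union>k. T k"] conjI) (rule sub, rule mT[unfolded x_def y_def])
    qed
    show ?case
    proof (cases "\<bar>wprod a (j # J)\<bar> \<le> \<bar>wprod a (i # I)\<bar>")
      case True
      then show ?thesis using step[OF Suc.prems(1) _ Suc.prems(2)] by blast
    next
      case False
      then have le: "\<bar>wprod a (i # I)\<bar> \<le> \<bar>wprod a (j # J)\<bar>" by linarith
      have "j \<noteq> i" using Suc.prems(1) by blast
      from step[OF this le Suc.prems(3)] show ?thesis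
        by (simp add: overlap_sym[of _ "j # J"] mult.commute)
    qed
  qed
  show thesis
    by (rule that[OF C \<alpha>]) (use main in \<open>simp add: \<theta>_def\<close>)
qed

text \<open>Single letters have comparable widths, so the preceding bound applies with every
  \<open>n\<close> to the same set and tends to 0; a countable union of balls removes the bound on
  \<open>t\<close>.\<close>

lemma negligible_overlap:
  assumes "i \<noteq> j"
  shows "negligible {t. overlap t [i] [j]}"
proof -
  have "negligible {t \<in> cball 0 R. overlap t [i] [j]}" if R: "0 < R" for R
  proof -
    obtain C \<alpha> where C: "0 < C" and \<alpha>: "\<And>i. \<alpha> \<le> \<bar>a i\<bar>" and
      main: "\<And>n i j I J. i \<noteq> j \<Longrightarrow> \<alpha> * \<bar>wprod a (i # I)\<bar> \<le> \<bar>wprod a (j # J)\<bar> \<Longrightarrow> \<alpha> * \<bar>wprod a (j # J)\<bar> \<le> \<bar>wprod a (i # I)\<bar> \<Longrightarrow>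
      \<exists>T\<in>lmeasurable. {t \<in> cball 0 R. overlap t (i # I) (j # J)} \<subseteq> T \<and>
        measure lebesgue T \<le> C * (\<Sum>i\<in>UNIV. \<bar>a i\<bar> powr (1/2)) ^ n * sqrt (\<bar>wprod a (i # I)\<bar> * \<bar>wprod a (j # J)\<bar>)"
      by (rule overlap_measure[OF R]) blast
    define \<theta> where "\<theta> = (\<Sum>i\<in>UNIV. \<bar>a i\<bar> powr (1/2))"
    have \<theta>: "0 \<le> \<theta>" "\<theta> < 1" using small by (auto simp: \<theta>_def intro: sum_nonneg)
    have a1: "\<bar>a i\<bar> \<le> 1" for i using a_le_q[of i] q_less by linarith
    have comp: "\<alpha> * \<bar>a k\<bar> \<le> \<bar>a l\<bar>" for k l
      using mult_mono[OF \<alpha>[of l] a1[of k]] by simp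
    define z where "z = sqrt (\<bar>a i\<bar> * \<bar>a j\<bar>)"
    show ?thesis
      unfolding negligible_outer_le
    proof (intro allI impI)
      fix e :: real assume e: "0 < e"
      have "(\<lambda>n. C * \<theta> ^ n * z) \<longlonglongrightarrow> C * 0 * z"
        by (intro tendsto_intros LIMSEQ_power_zero) (use \<theta> in auto)
      then have "\<forall>\<^sub>F n in sequentially. C * \<theta> ^ n * z < e"
        by (rule order_tendstoD) (use e in auto)
      then obtain n where n: "C * \<theta> ^ n * z < e" by (auto simp: eventually_sequentially)
      obtain T where "T \<in> lmeasurable" "{t \<in> cball 0 R. overlap t [i] [j]} \<subseteq> T"
        "measure lebesgue T \<le> C * \<theta> ^ n * z"
        using main[OF assms, of "[]" "[]" n, unfolded wprod_simps mult_1_right \<theta>_def[symmetric] z_def[symmetric],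
            OF comp comp] by blast
      then show "\<exists>T. {t \<in> cball 0 R. overlap t [i] [j]} \<subseteq> T \<and> T \<in> lmeasurable \<and> measure lebesgue T \<le> e"
        using n by (intro exI[of _ T] conjI) (assumption+, linarith)
    qed
  qed
  then have "negligible (\<Union>n. {t \<in> cball 0 (real (Suc n)). overlap t [i] [j]})"
    by (intro negligible_countable_Union) auto
  moreover have "{t. overlap t [i] [j]} \<subseteq> (\<Union>n. {t \<in> cball 0 (real (Suc n)). overlap t [i] [j]})"
  proof
    fix t assume t: "t \<in> {t. overlap t [i] [j]}"
    obtain n where "norm t < real n" using reals_Archimedean2 by blast
    then have "t \<in> cball 0 (real (Suc n))" by simp
    then show "t \<in> (\<Union>n. {t \<in> cball 0 (real (Suc n)). overlap t [i] [j]})" using t by blast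
  qed
  ultimately show ?thesis by (rule negligible_subset)
qed

section \<open>A uniform horizontal gap between cylinders\<close>

definition separated :: "real ^ 2 ^ 'i \<Rightarrow> real \<Rightarrow> bool" where
  "separated t \<delta> \<longleftrightarrow> 0 < \<delta> \<and> (\<forall>i j. i \<noteq> j \<longrightarrow>
     (\<forall>x\<in>A t. \<forall>y\<in>A t. \<delta> \<le> \<bar>diag_affine a c t i x $ 1 - diag_affine a c t j y $ 1\<bar>))"

lemma separatedI:
  assumes "\<And>i j. i \<noteq> j \<Longrightarrow> \<not> overlap t [i] [j]"
  shows "\<exists>\<delta>. separated t \<delta>"
proof -
  have "\<exists>\<delta>>0. i \<noteq> j \<longrightarrow> (\<forall>x\<in>A t. \<forall>y\<in>A t. \<delta> \<le> \<bar>diag_affine a c t i x $ 1 - diag_affine a c t j y $ 1\<bar>)" for i j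
  proof (cases "i = j")
    case False
    define S where "S k = (\<lambda>x. diag_affine a c t k x $ 1) ` A t" for k
    have S: "compact (S k)" for k
      unfolding S_def diag_affine_component
      by (intro compact_continuous_image A_compact continuous_intros)
    have "S i \<inter> S j = {}"
      using assms[OF False] unfolding overlap_def S_def by (auto simp del: diag_affine_component)
    then obtain d where "0 < d" "\<forall>x\<in>S i. \<forall>y\<in>S j. d \<le> dist x y"
      using separate_compact_closed[OF S compact_imp_closed[OF S]] by blast
    then show ?thesis unfolding S_def dist_real_def by blast
  qed (auto intro: exI[of _ 1])
  then obtain d where d: "\<And>i j. 0 < d i j" "\<And>i j x y. i \<noteq> j \<Longrightarrow> x \<in> A t \<Longrightarrow> y \<in> A t \<Longrightarrow>
     d i j \<le> \<bar>diag_affine a c t i x $ 1 - diag_affine a c t j y $ 1\<bar>" by metis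
  define \<delta> where "\<delta> = Min (range (\<lambda>(i, j). d i j))"
  have "\<delta> \<le> d i j" for i j unfolding \<delta>_def by (intro Min_le) auto
  moreover have "0 < \<delta>" unfolding \<delta>_def using d(1) by (subst Min_gr_iff) auto
  ultimately show ?thesis unfolding separated_def using d(2) order.trans by meson
qed

lemma AE_separated: "AE t in lebesgue. \<exists>\<delta>. separated t \<delta>"
proof -
  have "AE t in lebesgue. \<forall>i j. i \<noteq> j \<longrightarrow> \<not> overlap t [i] [j]"
  proof (intro eventually_all_finite)
    fix i j
    show "AE t in lebesgue. i \<noteq> j \<longrightarrow> \<not> overlap t [i] [j]"
    proof (cases "i = j")
      case False
      have "AE t in lebesgue. t \<notin> {t. overlap t [i] [j]}"
        using negligible_overlap[OF False] by (intro AE_not_in) (simp add: negligible_iff_null_sets)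
      then show ?thesis by eventually_elim simp
    qed simp
  qed
  then show ?thesis by eventually_elim (rule separatedI, blast)
qed

text \<open>The common prefix \<open>u\<close> acts on the first coordinate as an affine map of
  ratio \<open>wprod a u\<close> and scales the first-level gap accordingly.\<close>

lemma separated_words:
  assumes "separated t \<delta>" "i \<noteq> j" "x \<in> A t" "y \<in> A t"
  shows "\<delta> * \<bar>wprod a u\<bar> \<le>
    \<bar>fw (diag_affine a c t) (u @ i # v) x $ 1 - fw (diag_affine a c t) (u @ j # w) y $ 1\<bar>"
proof -
  let ?f = "diag_affine a c t"
  have mem: "fw ?f w x \<in> A t" if "x \<in> A t" for w x
    using fw_cover[OF A_eq, of t "length w"] that by (auto simp: words_def)
  have "fw ?f (u @ i # v) x $ 1 - fw ?f (u @ j # w) y $ 1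
      = wprod a u * (?f i (fw ?f v x) $ 1 - ?f j (fw ?f w y) $ 1)"
    by (simp only: fw_append fw_diag_affine(1) fw.simps) (simp add: algebra_simps)
  moreover have "\<delta> \<le> \<bar>?f i (fw ?f v x) $ 1 - ?f j (fw ?f w y) $ 1\<bar>"
    using assms mem unfolding separated_def by blast
  ultimately show ?thesis
    by (simp only: abs_mult mult.commute[of \<delta>] mult_left_mono abs_ge_zero)
qed

end

section \<open>Density of the vertical projection\<close>

lemma sum_words_add:
  fixes f :: "'i::finite list \<Rightarrow> 'b::comm_monoid_add"
  shows "(\<Sum>w\<in>words (m + n). f w) = (\<Sum>u\<in>words m. \<Sum>v\<in>words n. f (u @ v))"
  by (induction m arbitrary: f) (simp_all add: sum_words_Suc)

lemma longest_common_prefix_split: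
  "length u = length v \<Longrightarrow> u \<noteq> v \<Longrightarrow>
    \<exists>z i j u' v'. i \<noteq> j \<and> u = z @ i # u' \<and> v = z @ j # v' \<and> longest_common_prefix u v = z"
proof (induction u v rule: list_induct2)
  case (Cons x xs y ys)
  show ?case
  proof (cases "x = y")
    case True
    then obtain z i j u' v' where "i \<noteq> j" "xs = z @ i # u'" "ys = z @ j # v'" "longest_common_prefix xs ys = z"
      using Cons by blast
    then show ?thesis using True by (intro exI[of _ "x # z"] exI[of _ i] exI[of _ j] exI[of _ u'] exI[of _ v']) simp
  next
    case False
    then show ?thesis by (intro exI[of _ "[]"] exI[of _ x] exI[of _ y] exI[of _ xs] exI[of _ ys]) simp
  qed
qed simp

text \<open>Interpolates between the exponents 0 and 3 of the bump estimate; it is used with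
  \<open>2 + \<kappa>\<close>.\<close>

lemma min_one_power3_le_powr:
  fixes x \<tau> :: real
  assumes "0 < x" "0 \<le> \<tau>" "\<tau> \<le> 3"
  shows "min 1 (x ^ 3) \<le> x powr \<tau>"
proof (cases "x \<le> 1")
  case True
  have "x ^ 3 = x powr 3" using assms by simp
  also have "\<dots> \<le> x powr \<tau>" using assms True by (intro powr_mono') auto
  finally show ?thesis by simp
next
  case False
  then have "1 \<le> x powr \<tau>" using assms by (intro ge_one_powr_ge_zero) auto
  then show ?thesis by simp
qed

text \<open>By Fatou's lemma the lower limit has finite integral, so it is finite almost everywhere.
  This bounds \<open>f N x\<close> for infinitely many \<open>N\<close>, which depend on
  \<open>x\<close>.\<close>

lemma AE_liminf_finite:
  fixes f :: "nat \<Rightarrow> 'a \<Rightarrow> real"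
  assumes f: "\<And>N. f N \<in> borel_measurable M" "\<And>N x. 0 \<le> f N x"
    and int: "\<And>N. integrable M (f N)" "\<And>N. (\<integral>x. f N x \<partial>M) \<le> B"
  shows "AE x in M. \<exists>K. \<forall>N0. \<exists>N\<ge>N0. f N x < K"
proof -
  have "(\<integral>\<^sup>+x. liminf (\<lambda>N. ennreal (f N x)) \<partial>M) \<le> liminf (\<lambda>N. \<integral>\<^sup>+x. ennreal (f N x) \<partial>M)"
    by (intro nn_integral_liminf) (use f in measurable)
  also have "\<dots> \<le> liminf (\<lambda>N::nat. ennreal B)"
    using int f by (intro Liminf_mono always_eventually allI)
      (auto simp: nn_integral_eq_integral ennreal_leI)
  also have "\<dots> < \<infinity>" by (simp add: Liminf_const)
  finally have fin: "(\<integral>\<^sup>+x. liminf (\<lambda>N. ennreal (f N x)) \<partial>M) \<noteq> \<infinity>" by simp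
  have "AE x in M. liminf (\<lambda>N. ennreal (f N x)) \<noteq> \<infinity>"
    by (rule nn_integral_PInf_AE[OF _ fin]) (use f in measurable)
  then show ?thesis
  proof eventually_elim
    case (elim x)
    then obtain K where K: "0 \<le> K" "liminf (\<lambda>N. ennreal (f N x)) = ennreal K"
      by (metis ennreal_cases infinity_ennreal_def)
    have "\<exists>N\<ge>N0. f N x < K + 1" for N0
    proof (rule ccontr)
      assume "\<not> ?thesis"
      then have "\<forall>N\<ge>N0. ennreal (K + 1) \<le> ennreal (f N x)"
        by (auto simp: not_less intro!: ennreal_leI)
      then have "\<forall>\<^sub>F N in sequentially. ennreal (K + 1) \<le> ennreal (f N x)"
        by (auto simp: eventually_sequentially)
      then have "ennreal (K + 1) \<le> ennreal K" unfolding K(2)[symmetric] by (rule Liminf_bounded)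
      then show False using K(1) by (simp add: ennreal_le_iff)
    qed
    then show ?case by blast
  qed
qed

context diag_ifs
begin

section \<open>Exponents and weights of the vertical energy\<close>

definition p :: "'i \<Rightarrow> real" where "p i = \<bar>c i\<bar> * \<bar>a i\<bar> powr (s - 1)"

lemma p_nonneg: "0 \<le> p i" by (simp add: p_def)

lemma p_sum: "(\<Sum>i\<in>UNIV. p i) = 1" using dim by (simp add: p_def)

lemma abs_c_pos: "0 < \<bar>c i\<bar>" using ac[of i] by linarith

lemma abs_a_le_1: "\<bar>a i\<bar> \<le> 1" using a_le_q[of i] q_less by linarith

lemma s_gt: "5 / 4 < s"
proof (rule ccontr)
  assume "\<not> 5 / 4 < s"
  then have "(\<Sum>i\<in>UNIV. \<bar>c i\<bar> * \<bar>a i\<bar> powr (1/4)) \<le> (\<Sum>i\<in>UNIV. \<bar>c i\<bar> * \<bar>a i\<bar> powr (s - 1))"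
    using abs_a_le_1 by (intro sum_mono mult_left_mono powr_mono') auto
  then show False using large dim by linarith
qed

text \<open>The cap 1 keeps \<open>2 + \<kappa>\<close> within the three powers gained for a pair of
  words; the other bound keeps \<open>2 * (s - 1) - \<kappa>\<close> at least 1/2.\<close>

definition \<kappa> :: real where "\<kappa> = min 1 (2 * (s - 1) - 1/2)"

lemma \<kappa>: "0 < \<kappa>" "\<kappa> \<le> 1" "1/2 \<le> 2 * (s - 1) - \<kappa>"
  using s_gt by (auto simp: \<kappa>_def min_def)

definition prefix_weight :: "'i \<Rightarrow> real" where "prefix_weight i = \<bar>c i\<bar> powr - (2 + \<kappa>)"

lemma energy_sum: "(\<Sum>i\<in>UNIV. (p i)\<^sup>2 * prefix_weight i) \<le> (\<Sum>i\<in>UNIV. \<bar>a i\<bar> powr (1/2))"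
proof (rule sum_mono)
  fix i
  have "(p i)\<^sup>2 * prefix_weight i = (\<bar>c i\<bar> powr 2 * \<bar>c i\<bar> powr - (2 + \<kappa>)) * (\<bar>a i\<bar> powr (s - 1))\<^sup>2"
    using abs_c_pos[of i] unfolding p_def prefix_weight_def by (simp add: power_mult_distrib)
  also have "\<dots> = \<bar>c i\<bar> powr - \<kappa> * \<bar>a i\<bar> powr (2 * (s - 1))"
    unfolding powr_add[symmetric] power2_eq_square by (simp add: algebra_simps)
  \<comment> \<open>The exponent is negative, so \<open>|a i| < |c i|\<close> allows
    \<open>c\<close> to be traded for \<open>a\<close>.\<close>
  also have "\<dots> \<le> \<bar>a i\<bar> powr - \<kappa> * \<bar>a i\<bar> powr (2 * (s - 1))"
    using ac[of i] \<kappa> by (intro mult_right_mono powr_mono2') auto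
  also have "\<dots> = \<bar>a i\<bar> powr (2 * (s - 1) - \<kappa>)"
    unfolding powr_add[symmetric] by simp
  also have "\<dots> \<le> \<bar>a i\<bar> powr (1/2)"
    using abs_a_le_1 \<kappa> by (intro powr_mono') auto
  finally show "(p i)\<^sup>2 * prefix_weight i \<le> \<bar>a i\<bar> powr (1/2)" .
qed

definition ypos :: "real ^ 2 ^ 'i \<Rightarrow> 'i list \<Rightarrow> real" where
  "ypos t w = pt c (\<lambda>i. t $ i $ 2) w"

lemma linear_ypos: "linear (\<lambda>t. ypos t w)"
  unfolding ypos_def by (rule linear_pt)

lemma continuous_on_ypos: "continuous_on S (\<lambda>t. ypos t w)"
  by (intro linear_continuous_on linear_conv_bounded_linear[THEN iffD1] linear_ypos)

lemma abs_wprod_c_le: "\<bar>wprod c w\<bar> \<le> (1/2) ^ length w"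
proof -
  have "\<bar>wprod c w\<bar> \<le> wprod (\<lambda>_. 1/2) w"
    unfolding abs_wprod using ac by (intro wprod_mono) (auto intro: less_imp_le)
  then show ?thesis by (simp add: wprod_const)
qed

lemma wprod_prefix_weight: "wprod prefix_weight w = \<bar>wprod c w\<bar> powr - (2 + \<kappa>)"
  unfolding prefix_weight_def abs_wprod by (rule wprod_powr) simp

text \<open>For words that split after a prefix \<open>z\<close>, the difference of positions is
  \<open>wprod c z\<close> times a transversal form. The weight of the prefix is the price of that
  small factor at exponent \<open>2 + \<kappa>\<close>.\<close>

lemma integral_bump_pair:
  assumes R: "0 \<le> R"
  obtains C where "0 < C"
    "\<And>N n u v. u \<in> words N \<Longrightarrow> v \<in> words N \<Longrightarrow> n \<le> N \<Longrightarrow>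
      (\<integral>t. bump R t * tent_diff ((1/2)^n) (ypos t u - ypos t v) \<partial>lborel)
        \<le> C * ((1/2)^n) powr (3 + \<kappa>) * wprod prefix_weight (longest_common_prefix u v)"
proof -
  obtain C0 where C0: "0 < C0"
    "\<And>(L :: real ^ 2 ^ 'i \<Rightarrow> real) v m. linear L \<Longrightarrow> norm v \<le> 2 \<Longrightarrow> L v \<noteq> 0 \<Longrightarrow> 0 < m \<Longrightarrow>
       \<bar>\<integral>t. bump R t * tent_diff m (L t) \<partial>lborel\<bar> \<le> C0 * m * min 1 ((m / \<bar>L v\<bar>)^3)"
    by (rule integral_bump_tent_diff_le[OF R]) blast
  define B where "B = (\<integral>t. bump R (t :: real ^ 2 ^ 'i) \<partial>lborel)"
  have B: "0 \<le> B" unfolding B_def by (simp add: bump_nonneg)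
  define \<eta> where "\<eta> = 2 * (1 - 2 * q)"
  have \<eta>: "0 < \<eta>" using q_less by (simp add: \<eta>_def)
  define C where "C = C0 * \<eta> powr - (2 + \<kappa>) + 2 * B"
  show thesis
  proof
    show "0 < C" using C0 \<eta> B by (simp add: C_def add_pos_nonneg)
    fix N n and u v :: "'i list"
    assume u: "u \<in> words N" and v: "v \<in> words N" and n: "n \<le> N"
    define m :: real where "m = (1/2)^n"
    have m: "0 < m" by (simp add: m_def)
    define z where "z = longest_common_prefix u v"
    have cz: "0 < \<bar>wprod c z\<bar>" by (rule abs_wprod_c_pos)
    define X where "X = m * (m / \<bar>wprod c z\<bar>) powr (2 + \<kappa>)"
    have X0: "0 \<le> X" using m by (simp add: X_def)
    have X: "X = m powr (3 + \<kappa>) * wprod prefix_weight z"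
    proof -
      have "X = m powr 1 * (m powr (2 + \<kappa>) / \<bar>wprod c z\<bar> powr (2 + \<kappa>))"
        unfolding X_def using m cz by (subst powr_divide) auto
      also have "\<dots> = m powr (1 + (2 + \<kappa>)) * wprod prefix_weight z"
        unfolding wprod_prefix_weight powr_minus powr_add[of m 1] by (simp add: divide_inverse)
      finally show ?thesis by simp
    qed
    have "(\<integral>t. bump R t * tent_diff m (ypos t u - ypos t v) \<partial>lborel) \<le> C * X"
    proof (cases "u = v")
      \<comment> \<open>Equal words offer no transversality. But \<open>n \<le> N\<close> makes
        \<open>m\<close> at least \<open>|wprod c u|\<close>, so the trivial bound
        \<open>2 * B * m\<close> is good enough.\<close>
      case True
      have "longest_common_prefix w w = w" for w :: "'i list" by (induction w) auto
      then have zu: "z = u" using True by (simp add: z_def)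
      have "\<bar>wprod c z\<bar> \<le> (1/2) ^ N" using abs_wprod_c_le[of z] u by (simp add: zu words_def)
      also have "\<dots> \<le> m" unfolding m_def using n by (intro power_decreasing) auto
      finally have "1 \<le> m / \<bar>wprod c z\<bar>" using cz by simp
      then have "1 \<le> (m / \<bar>wprod c z\<bar>) powr (2 + \<kappa>)" using \<kappa> by (intro ge_one_powr_ge_zero) auto
      then have mX: "m * 1 \<le> X" unfolding X_def using m by (intro mult_left_mono) auto
      have "tent_diff m 0 = 2 * m" using m by (simp add: tent_diff_def tent_def)
      then have "(\<integral>t. bump R t * tent_diff m (ypos t u - ypos t v) \<partial>lborel) = 2 * B * m"
        using True by (simp add: B_def)
      also have "\<dots> \<le> 2 * B * X" using mX B by (intro mult_left_mono) auto
      also have "\<dots> \<le> C * X"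
        unfolding C_def using C0 X0 by (intro mult_right_mono) auto
      finally show ?thesis .
    next
      case False
      obtain i j u' v' where uv: "i \<noteq> j" "u = z @ i # u'" "v = z @ j # v'"
        using longest_common_prefix_split[of u v] False u v unfolding z_def words_def by auto
      define L where "L t = ypos t u - ypos t v" for t
      have L: "linear L" unfolding L_def by (intro linear_compose_sub linear_ypos)
      have "L t = wprod c z * (ypos t (i # u') - ypos t (j # v'))" for t
        unfolding L_def ypos_def uv(2,3) pt_append by (simp add: right_diff_distrib)
      moreover have "\<eta> \<le> ypos (swap_dir 2 i j) (i # u') - ypos (swap_dir 2 i j) (j # v')"
        unfolding \<eta>_def ypos_def by (rule transversality[where r = c, OF c_le_q q_less uv(1)])
      ultimately have Lv: "\<bar>wprod c z\<bar> * \<eta> \<le> \<bar>L (swap_dir 2 i j)\<bar>"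
        using \<eta> by (auto simp: abs_mult intro!: mult_left_mono)
      define x where "x = m / \<bar>L (swap_dir 2 i j)\<bar>"
      have Lpos: "0 < \<bar>L (swap_dir 2 i j)\<bar>" using Lv cz \<eta> by (smt (verit) mult_pos_pos)
      have x: "0 < x" using m Lpos by (simp add: x_def)
      have xle: "x \<le> m / (\<bar>wprod c z\<bar> * \<eta>)"
        unfolding x_def using m Lv cz \<eta> Lpos by (intro divide_left_mono mult_pos_pos) auto
      have "(\<integral>t. bump R t * tent_diff m (L t) \<partial>lborel) \<le> C0 * m * min 1 (x ^ 3)"
        using C0(2)[OF L norm_swap_dir_le _ m, of 2 i j] Lpos unfolding x_def by (simp add: abs_le_iff)
      also have "\<dots> \<le> C0 * m * x powr (2 + \<kappa>)"
        using C0 m \<kappa> x by (intro mult_left_mono min_one_power3_le_powr) auto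
      also have "\<dots> \<le> C0 * m * (m / (\<bar>wprod c z\<bar> * \<eta>)) powr (2 + \<kappa>)"
        using C0 m \<kappa> x xle by (intro mult_left_mono powr_mono2) auto
      also have "\<dots> = C0 * \<eta> powr - (2 + \<kappa>) * X"
      proof -
        have "(m / (\<bar>wprod c z\<bar> * \<eta>)) powr (2 + \<kappa>) = (m / \<bar>wprod c z\<bar> / \<eta>) powr (2 + \<kappa>)" by simp
        also have "\<dots> = (m / \<bar>wprod c z\<bar>) powr (2 + \<kappa>) / \<eta> powr (2 + \<kappa>)"
          using m cz \<eta> by (subst powr_divide) auto
        finally show ?thesis unfolding X_def powr_minus by (simp add: divide_inverse)
      qed
      also have "\<dots> \<le> C * X"
        unfolding C_def using B X0 by (intro mult_right_mono) auto
      finally show ?thesis unfolding L_def .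
    qed
    then show "(\<integral>t. bump R t * tent_diff ((1/2)^n) (ypos t u - ypos t v) \<partial>lborel)
        \<le> C * ((1/2)^n) powr (3 + \<kappa>) * wprod prefix_weight (longest_common_prefix u v)"
      unfolding X m_def z_def by (simp add: mult.assoc)
  qed
qed

abbreviation energy :: "nat \<Rightarrow> real ^ 2 ^ 'i \<Rightarrow> real \<Rightarrow> real" where
  "energy N t m \<equiv> haar_energy (words N) (wprod p) (ypos t) m"

lemma continuous_on_energy: "continuous_on S (\<lambda>t. energy N t m)"
  unfolding haar_energy_def[OF finite_words]
  by (intro continuous_on_sum continuous_on_mult continuous_on_const continuous_on_tent_diff
      continuous_on_diff continuous_on_ypos)

lemma integral_energy:
  assumes R: "0 \<le> R"
  obtains C where "0 < C"
    "\<And>N n. n \<le> N \<Longrightarrow> (\<integral>t. bump R t * energy N t ((1/2)^n) \<partial>lborel) \<le> C * ((1/2)^n) powr (3 + \<kappa>)"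
proof -
  obtain C where C: "0 < C"
    "\<And>N n u v. u \<in> words N \<Longrightarrow> v \<in> words N \<Longrightarrow> n \<le> N \<Longrightarrow>
      (\<integral>t. bump R t * tent_diff ((1/2)^n) (ypos t u - ypos t v) \<partial>lborel)
        \<le> C * ((1/2)^n) powr (3 + \<kappa>) * wprod prefix_weight (longest_common_prefix u v)"
    by (rule integral_bump_pair[OF R]) blast
  define \<theta> where "\<theta> = (\<Sum>i\<in>UNIV. \<bar>a i\<bar> powr (1/2))"
  have \<theta>: "\<theta> < 1" using small by (simp add: \<theta>_def)
  show thesis
  proof
    show "0 < C * (1 / (1 - \<theta>))" using C \<theta> by simp
    fix N n :: nat assume n: "n \<le> N"
    define m :: real where "m = (1/2)^n"
    have int: "integrable lborel (\<lambda>t. bump R t * tent_diff m (ypos t u - ypos t v))" for u v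
      using integrable_bump_mult[OF R, of "\<lambda>t. tent_diff m (ypos t u - ypos t v)" 0]
      by (simp add: continuous_on_tent_diff continuous_on_diff continuous_on_ypos)
    have "(\<integral>t. bump R t * energy N t m \<partial>lborel)
      = (\<integral>t. (\<Sum>u\<in>words N. \<Sum>v\<in>words N. wprod p u * wprod p v * (bump R t * tent_diff m (ypos t u - ypos t v))) \<partial>lborel)"
      unfolding haar_energy_def[OF finite_words] sum_distrib_left by (simp add: ac_simps)
    also have "\<dots> = (\<Sum>u\<in>words N. \<Sum>v\<in>words N. wprod p u * wprod p v * (\<integral>t. bump R t * tent_diff m (ypos t u - ypos t v) \<partial>lborel))"
      by (subst Bochner_Integration.integral_sum, intro Bochner_Integration.integrable_sum integrable_mult_right int,
          intro sum.cong refl, subst Bochner_Integration.integral_sum, intro integrable_mult_right int, simp)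
    also have "\<dots> \<le> (\<Sum>u\<in>words N. \<Sum>v\<in>words N. wprod p u * wprod p v * (C * m powr (3 + \<kappa>) * wprod prefix_weight (longest_common_prefix u v)))"
      unfolding m_def using n by (intro sum_mono mult_left_mono C(2) mult_nonneg_nonneg wprod_nonneg p_nonneg)
    also have "\<dots> = C * m powr (3 + \<kappa>) * (\<Sum>u\<in>words N. \<Sum>v\<in>words N. wprod p u * wprod p v * wprod prefix_weight (longest_common_prefix u v))"
      unfolding sum_distrib_left by (simp add: ac_simps)
    also have "\<dots> \<le> C * m powr (3 + \<kappa>) * (1 / (1 - \<theta>))"
      using C energy_sum \<theta> unfolding \<theta>_def
      by (intro mult_left_mono sum_words_common_prefix_le p_nonneg p_sum) (auto simp: prefix_weight_def)
    finally show "(\<integral>t. bump R t * energy N t ((1/2)^n) \<partial>lborel) \<le> C * (1 / (1 - \<theta>)) * ((1/2)^n) powr (3 + \<kappa>)"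
      unfolding m_def by (simp add: ac_simps)
  qed
qed

text \<open>Fatou's lemma supplies infinitely many levels \<open>N\<close>; at each of them all
  dyadic scales from 1/2 down to \<open>(1/2)^N\<close> are covered with one constant. Half of
  \<open>\<kappa>\<close> is spent on summing over these scales.\<close>

definition regular :: "real ^ 2 ^ 'i \<Rightarrow> real \<Rightarrow> bool" where
  "regular t K \<longleftrightarrow> 0 \<le> K \<and> (\<forall>N0. \<exists>N\<ge>N0. \<forall>n. 1 \<le> n \<longrightarrow> n \<le> N \<longrightarrow>
     energy N t ((1/2)^n) \<le> K * ((1/2)^n) powr (3 + \<kappa>/2))"

lemma energy_nonneg: "0 < m \<Longrightarrow> 0 \<le> energy N t m"
  by (rule haar_energy_nonneg) auto

lemma AE_regular_ball:
  assumes R: "0 \<le> R"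
  shows "AE t in lborel. norm t < R \<longrightarrow> (\<exists>K. regular t K)"
proof -
  obtain C where C: "0 < C"
    "\<And>N n. n \<le> N \<Longrightarrow> (\<integral>t. bump R t * energy N t ((1/2)^n) \<partial>lborel) \<le> C * ((1/2)^n) powr (3 + \<kappa>)"
    by (rule integral_energy[OF R]) blast
  \<comment> \<open>With these weights the integral at scale \<open>n\<close> is of order
    \<open>((1/2)^n) powr (\<kappa>/2)\<close>, summable in \<open>n\<close>. A bound on the single
    number \<open>f N t\<close> then controls every scale, the terms being nonnegative.\<close>
  define b :: "nat \<Rightarrow> real" where "b n = ((1/2)^n) powr - (3 + \<kappa>/2)" for n
  have b: "0 < b n" for n by (simp add: b_def)
  define f where "f N t = (\<Sum>n=1..N. b n * (bump R t * energy N t ((1/2)^n)))" for N t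
  have int: "integrable lborel (\<lambda>t. bump R t * energy N t m)" for N m
    using integrable_bump_mult[OF R, of "\<lambda>t. energy N t m" 0] by (simp add: continuous_on_energy)
  have "AE t in lborel. \<exists>K. \<forall>N0. \<exists>N\<ge>N0. f N t < K"
  proof (rule AE_liminf_finite)
    fix N
    show fint: "integrable lborel (f N)"
      unfolding f_def by (intro Bochner_Integration.integrable_sum integrable_mult_right int)
    then show "f N \<in> borel_measurable lborel" by (rule borel_measurable_integrable)
    show "0 \<le> f N x" for x
      unfolding f_def using b by (intro sum_nonneg mult_nonneg_nonneg bump_nonneg energy_nonneg) (auto intro: less_imp_le)
    have "(\<integral>t. f N t \<partial>lborel) = (\<Sum>n=1..N. b n * (\<integral>t. bump R t * energy N t ((1/2)^n) \<partial>lborel))"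
      unfolding f_def by (subst Bochner_Integration.integral_sum, intro integrable_mult_right int, simp)
    also have "\<dots> \<le> (\<Sum>n=1..N. b n * (C * ((1/2)^n) powr (3 + \<kappa>)))"
      using b by (intro sum_mono mult_left_mono C(2)) (auto intro: less_imp_le)
    also have "\<dots> = C * (\<Sum>n=1..N. ((1/2)^n) powr (\<kappa>/2))"
    proof -
      have eq: "b n * (C * ((1/2)^n) powr (3 + \<kappa>)) = C * ((1/2)^n) powr (\<kappa>/2)" for n
      proof -
        have "b n * ((1/2)^n) powr (3 + \<kappa>) = ((1/2)^n) powr (- (3 + \<kappa>/2) + (3 + \<kappa>))"
          unfolding b_def powr_add ..
        also have "- (3 + \<kappa>/2) + (3 + \<kappa>) = \<kappa>/2" by simp
        finally show ?thesis by simp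
      qed
      show ?thesis unfolding sum_distrib_left eq ..
    qed
    also have "\<dots> \<le> C * (1 / (1 - (1/2) powr (\<kappa>/2)))"
      using C \<kappa> by (intro mult_left_mono sum_dyadic_powr_le) auto
    finally show "(\<integral>t. f N t \<partial>lborel) \<le> C * (1 / (1 - (1/2) powr (\<kappa>/2)))" .
  qed
  then show ?thesis
  proof eventually_elim
    case (elim t)
    then obtain K where K: "\<And>N0. \<exists>N\<ge>N0. f N t < K" by blast
    show ?case
    proof
      assume "norm t < R"
      then have W: "0 < bump R t" by (rule bump_pos)
      have le: "energy N t ((1/2)^n) \<le> max 0 (K / bump R t) * ((1/2)^n) powr (3 + \<kappa>/2)"
        if "f N t < K" "1 \<le> n" "n \<le> N" for N n
      proof -
        have "b n * (bump R t * energy N t ((1/2)^n)) \<le> f N t"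
          unfolding f_def using that b
          by (intro member_le_sum mult_nonneg_nonneg bump_nonneg energy_nonneg) (auto intro: less_imp_le)
        then have "b n * (bump R t * energy N t ((1/2)^n)) \<le> K" using that by linarith
        then have "energy N t ((1/2)^n) \<le> K / bump R t * (1 / b n)"
          using W b[of n] by (simp add: field_simps)
        also have "1 / b n = ((1/2)^n) powr (3 + \<kappa>/2)"
          unfolding b_def powr_minus_divide by simp
        also have "K / bump R t * ((1/2)^n) powr (3 + \<kappa>/2) \<le> max 0 (K / bump R t) * ((1/2)^n) powr (3 + \<kappa>/2)"
          by (intro mult_right_mono) auto
        finally show ?thesis .
      qed
      have "regular t (max 0 (K / bump R t))"
        unfolding regular_def using K le by (metis max.cobounded1)
      then show "\<exists>K. regular t K" ..
    qed
  qed
qed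

lemma AE_regular: "AE t in lborel. \<exists>K. regular t K"
proof -
  have "AE t in lborel. \<forall>n. norm t < real n \<longrightarrow> (\<exists>K. regular t K)"
    unfolding AE_all_countable by (intro allI AE_regular_ball) simp
  then show ?thesis
    by eventually_elim (metis reals_Archimedean2)
qed

text \<open>A level \<open>N\<close> need not be one with energy bounds, so the mass of its words is
  redistributed to their descendants at a deeper level \<open>N'\<close> that is. Descendants stay
  within a multiple of \<open>(1/2)^N\<close>, which accounts for the additive term.\<close>

lemma regular_imp_density:
  assumes "regular t K"
  obtains C where "0 < C"
    "\<And>N x l. 0 < l \<Longrightarrow> (\<Sum>w\<in>{w \<in> words N. \<bar>ypos t w - x\<bar> \<le> l}. wprod p w) \<le> C * (l + (1/2)^N)"
proof -
  define B where "B = 1 + (K + 1) / 4 * (1 / (1 - (1/2) powr ((\<kappa>/2)/2)))"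
  have K: "0 \<le> K" using assms by (simp add: regular_def)
  have k1: "(1/2::real) powr ((\<kappa>/2)/2) < 1" using \<kappa> powr_less_mono2[of "(\<kappa>/2)/2" "1/2" 1] by simp
  have B: "1 \<le> B" unfolding B_def using K k1 by simp
  define M where "M = 1 + 2 * norm t"
  have M: "1 \<le> M" by (simp add: M_def)
  have pw: "0 \<le> wprod p w" for w by (intro wprod_nonneg p_nonneg)
  have sum1: "(\<Sum>w\<in>words N. wprod p w) = 1" for N by (simp add: sum_wprod p_sum)
  have ext: "\<bar>ypos t (w @ v) - ypos t w\<bar> \<le> M * (1/2)^N" if "w \<in> words N" for w v N
  proof -
    have "\<bar>t $ i $ 2\<bar> \<le> norm t" for i
      using Finite_Cartesian_Product.norm_nth_le[of "t $ i" 2] Finite_Cartesian_Product.norm_nth_le[of t i] by simp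
    then have "\<bar>ypos t v\<bar> \<le> norm t / (1 - q)"
      unfolding ypos_def using q_less by (intro abs_pt_le c_le_q) auto
    also have "\<dots> \<le> norm t / (1 / 2)"
      using q_less by (intro divide_left_mono) auto
    finally have "\<bar>ypos t v\<bar> \<le> M" by (simp add: M_def)
    then have "\<bar>wprod c w\<bar> * \<bar>ypos t v\<bar> \<le> (1/2)^N * M"
      using abs_wprod_c_le[of w] that by (intro mult_mono) (auto simp: words_def)
    then show ?thesis by (simp add: ypos_def pt_append abs_mult mult.commute)
  qed
  have main: "(\<Sum>w\<in>{w \<in> words N. \<bar>ypos t w - x\<bar> \<le> l}. wprod p w) \<le> 8 * B * (l + M * (1/2)^N)"
    (is "?S \<le> _") if l: "0 < l" for N x l
  proof -
    define l' where "l' = l + M * (1/2)^N"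
    have l': "0 < l'" using l M by (simp add: l'_def add_pos_nonneg)
    show ?thesis
    proof (cases "2 * l' < 1")
      \<comment> \<open>A window this large is covered by the total mass 1, which is below
        \<open>8 * l'\<close>.\<close>
      case False
      have "?S \<le> (\<Sum>w\<in>words N. wprod p w)" by (intro sum_mono2) (auto simp: pw)
      also have "\<dots> \<le> 8 * 1 * l'" unfolding sum1 using False by simp
      also have "\<dots> \<le> 8 * B * l'" using B l' by (intro mult_right_mono) auto
      finally show ?thesis unfolding l'_def .
    next
      case True
      obtain n0 where n0: "(1/2) ^ n0 < 2 * l'" using real_arch_pow_inv[of "2 * l'" "1/2"] l' by auto
      \<comment> \<open>The predecessor of \<open>n1\<close> yields a dyadic \<open>m\<close> with
        \<open>2 * l' \<le> m < 4 * l'\<close>. Within distance \<open>l'\<close> of the centre the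
        tent is then at least \<open>m / 2\<close>.\<close>
      define n1 where "n1 = (LEAST n. (1/2::real) ^ n < 2 * l')"
      have n1: "(1/2) ^ n1 < 2 * l'" unfolding n1_def by (rule LeastI[of _ n0]) (rule n0)
      then have "n1 \<noteq> 0" using True by (intro notI) simp
      then obtain n where n: "n1 = Suc n" by (cases n1) auto
      have "\<not> (1/2) ^ n < 2 * l'" using not_less_Least[of n "\<lambda>n. (1/2::real) ^ n < 2 * l'"] n unfolding n1_def by simp
      define m :: real where "m = (1/2)^n"
      have m: "0 < m" "2 * l' \<le> m" "m < 4 * l'"
        using \<open>\<not> (1/2) ^ n < 2 * l'\<close> n1 unfolding m_def n by auto
      obtain N' where N': "max N n \<le> N'"
        "\<forall>n. 1 \<le> n \<longrightarrow> n \<le> N' \<longrightarrow> energy N' t ((1/2)^n) \<le> K * ((1/2)^n) powr (3 + \<kappa>/2)"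
        using assms unfolding regular_def by blast
      obtain d where d: "N' = N + d" using N'(1) le_Suc_ex[of N N'] by auto
      have "?S = (\<Sum>w\<in>words N. if \<bar>ypos t w - x\<bar> \<le> l then wprod p w else 0)"
        by (simp add: sum.inter_filter)
      also have "\<dots> = (\<Sum>w\<in>words N. \<Sum>v\<in>words d. if \<bar>ypos t w - x\<bar> \<le> l then wprod p (w @ v) else 0)"
        by (intro sum.cong refl) (simp add: sum_distrib_left[symmetric] sum1)
      also have "\<dots> \<le> (\<Sum>w\<in>words N. \<Sum>v\<in>words d. wprod p (w @ v) * tent m (x - ypos t (w @ v)) * (2 / m))"
      proof (intro sum_mono)
        fix w v :: "'i list" assume w: "w \<in> words N"
        show "(if \<bar>ypos t w - x\<bar> \<le> l then wprod p (w @ v) else 0)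
          \<le> wprod p (w @ v) * tent m (x - ypos t (w @ v)) * (2 / m)"
        proof (cases "\<bar>ypos t w - x\<bar> \<le> l")
          case True
          then have "\<bar>x - ypos t (w @ v)\<bar> \<le> l'" using ext[OF w, of v] unfolding l'_def by linarith
          then have "m / 2 \<le> tent m (x - ypos t (w @ v))" using m unfolding tent_def by linarith
          then have "1 \<le> tent m (x - ypos t (w @ v)) * (2 / m)" using m by (simp add: field_simps)
          then have "wprod p (w @ v) * 1 \<le> wprod p (w @ v) * (tent m (x - ypos t (w @ v)) * (2 / m))"
            by (intro mult_left_mono pw)
          then show ?thesis using True by (simp only: if_True mult.assoc mult_1_right)
        next
          case False
          have "0 \<le> wprod p (w @ v) * tent m (x - ypos t (w @ v)) * (2 / m)"
            using m by (intro mult_nonneg_nonneg pw tent_nonneg) auto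
          then show ?thesis using False by simp
        qed
      qed
      also have "\<dots> = tent_mass (words N') (wprod p) (ypos t) m x * (2 / m)"
        unfolding d tent_mass_def[OF finite_words] sum_words_add sum_distrib_right ..
      also have "\<dots> \<le> (B * m\<^sup>2) * (2 / m)"
      proof (intro mult_right_mono)
        have "tent_mass (words N') (wprod p) (ypos t) m x
          \<le> (1 + (K + 1) / 4 * (\<Sum>k=1..n. ((1/2)^k) powr ((\<kappa>/2)/2))) * m\<^sup>2"
          unfolding m_def by (rule tent_mass_dyadic_le[where N = N']) (use N' K sum1 pw in auto)
        also have "\<dots> \<le> (1 + (K + 1) / 4 * (1 / (1 - (1/2) powr ((\<kappa>/2)/2)))) * m\<^sup>2"
          using K \<kappa> by (intro mult_right_mono add_left_mono mult_left_mono sum_dyadic_powr_le) auto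
        finally show "tent_mass (words N') (wprod p) (ypos t) m x \<le> B * m\<^sup>2"
          unfolding B_def .
      qed (use m in simp)
      also have "\<dots> = 2 * B * m" using m by (simp add: power2_eq_square)
      also have "\<dots> \<le> 2 * B * (4 * l')" using m B by (intro mult_left_mono) auto
      also have "\<dots> = 8 * B * l'" by simp
      finally show ?thesis unfolding l'_def .
    qed
  qed
  show thesis
  proof
    show "0 < 8 * B * M" using B M by simp
    fix N x and l :: real assume l: "0 < l"
    have "1 * l \<le> M * l" using M l by (intro mult_right_mono) auto
    then have "8 * B * (l + M * (1/2)^N) \<le> 8 * B * (M * (l + (1/2)^N))"
      using B by (intro mult_left_mono) (auto simp: algebra_simps)
    with main[OF l, of N x] show "(\<Sum>w\<in>{w \<in> words N. \<bar>ypos t w - x\<bar> \<le> l}. wprod p w) \<le> 8 * B * M * (l + (1/2)^N)"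
      by (simp only: mult.assoc)
  qed
qed

end

section \<open>Hausdorff measure of the attractor\<close>

lemma diam_pow_eq: "s \<noteq> 0 \<Longrightarrow> diam_pow s U = ennreal (diameter U powr s)"
  by (simp add: diam_pow_def diameter_empty)

text \<open>A finite cover is padded to a sequence with empty sets, on which \<open>diam_pow\<close>
  vanishes for every exponent.\<close>

lemma hausdorff_premeasure_le_finite_cover:
  assumes I: "finite I" and U: "\<And>i. i \<in> I \<Longrightarrow> bounded (U i) \<and> diameter (U i) \<le> \<delta>"
    and cov: "S \<subseteq> (\<Union>i\<in>I. U i)" and \<delta>: "0 \<le> \<delta>"
  shows "hausdorff_premeasure s \<delta> S \<le> (\<Sum>i\<in>I. diam_pow s (U i))"
proof -
  obtain h where h: "bij_betw h {0..<card I} I" using ex_bij_betw_nat_finite[OF I] by blast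
  define V where "V n = (if n < card I then U (h n) else {})" for n
  have hI: "h n \<in> I" if "n < card I" for n using h that by (auto simp: bij_betw_def)
  have "(\<Sum>n. diam_pow s (V n)) = (\<Sum>n\<in>{0..<card I}. diam_pow s (V n))"
    by (rule suminf_finite) (auto simp: V_def diam_pow_def)
  also have "\<dots> = (\<Sum>n\<in>{0..<card I}. diam_pow s (U (h n)))" by (simp add: V_def)
  also have "\<dots> = (\<Sum>i\<in>I. diam_pow s (U i))" by (rule sum.reindex_bij_betw[OF h])
  finally have eq: "(\<Sum>n. diam_pow s (V n)) = (\<Sum>i\<in>I. diam_pow s (U i))" .
  have "S \<subseteq> (\<Union>n. V n)"
  proof
    fix x assume "x \<in> S"
    then obtain i where i: "i \<in> I" "x \<in> U i" using cov by blast
    then obtain n where "n < card I" "i = h n" using bij_betw_imp_surj_on[OF h] by force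
    then show "x \<in> (\<Union>n. V n)" using i by (auto simp: V_def)
  qed
  moreover have "bounded (V n) \<and> diameter (V n) \<le> \<delta>" for n
    using U hI \<delta> by (auto simp: V_def diameter_empty)
  ultimately show ?thesis
    unfolding hausdorff_premeasure_def eq[symmetric] by (intro INF_lower) auto
qed

text \<open>Fattening the covering sets to open ones costs arbitrarily little, so by compactness a mass
  distribution at a finite level is enough.\<close>

lemma mass_distribution_compact:
  fixes X :: "'a::metric_space set" and W :: "nat \<Rightarrow> 'w set" and p :: "'w \<Rightarrow> real" and y :: "'w \<Rightarrow> 'a"
  assumes X: "compact X" and s: "0 < s" and C: "0 < C"
    and W: "\<And>N. finite (W N)" "\<And>N. (\<Sum>w\<in>W N. p w) = 1" "\<And>w. 0 \<le> p w"
    and y: "\<And>w. y w \<in> X"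
    and mass: "\<And>r. 0 < r \<Longrightarrow> \<exists>N0. \<forall>N\<ge>N0. \<forall>S. (\<forall>u\<in>S. \<forall>v\<in>S. dist u v \<le> r) \<longrightarrow>
       (\<Sum>w\<in>{w \<in> W N. y w \<in> S}. p w) \<le> C * r powr s"
  shows "0 < hausdorff_measure s X"
proof -
  have "ennreal (1 / C) \<le> hausdorff_premeasure s 1 X"
    unfolding hausdorff_premeasure_def
  proof (rule INF_greatest)
    fix U assume "U \<in> {U :: nat \<Rightarrow> 'a set. (\<forall>n. bounded (U n) \<and> diameter (U n) \<le> 1) \<and> X \<subseteq> (\<Union>n. U n)}"
    then have U: "\<And>n. bounded (U n)" "X \<subseteq> (\<Union>n. U n)" by auto
    define d where "d n = diameter (U n)" for n
    have d0: "0 \<le> d n" for n unfolding d_def by (rule diameter_ge_0[OF U(1)])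
    show "ennreal (1 / C) \<le> (\<Sum>n. diam_pow s (U n))"
    proof (rule ennreal_le_epsilon)
      fix \<epsilon> :: real assume \<epsilon>: "0 < \<epsilon>"
      have "\<exists>\<eta>>0. (d n + 2 * \<eta>) powr s \<le> d n powr s + \<epsilon> * (1/2)^Suc n" for n
      proof -
        \<comment> \<open>Continuity from the right; \<open>s > 0\<close> lets this include covering
          sets of diameter 0.\<close>
        have "((\<lambda>h. (d n + 2 * h) powr s) \<longlongrightarrow> (d n + 2 * 0) powr s) (at_right 0)"
          using s d0[of n]
          by (intro tendsto_powr' tendsto_intros) (auto simp: eventually_at_right_less intro!: eventually_at_rightI[of 0 1])
        then have "\<forall>\<^sub>F h in at_right 0. (d n + 2 * h) powr s < d n powr s + \<epsilon> * (1/2)^Suc n"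
          by (rule order_tendstoD) (use \<epsilon> in simp)
        then obtain b where "0 < b" "\<forall>h>0. h < b \<longrightarrow> (d n + 2 * h) powr s < d n powr s + \<epsilon> * (1/2)^Suc n"
          unfolding eventually_at_right_field by blast
        then have "(d n + 2 * (b / 2)) powr s < d n powr s + \<epsilon> * (1/2)^Suc n"
          by (metis half_gt_zero field_sum_of_halves less_add_same_cancel1)
        then show ?thesis using \<open>0 < b\<close> by (intro exI[of _ "b / 2"] conjI) simp_all
      qed
      then obtain \<eta> where \<eta>: "\<And>n. 0 < \<eta> n" "\<And>n. (d n + 2 * \<eta> n) powr s \<le> d n powr s + \<epsilon> * (1/2)^Suc n"
        by metis
      define V where "V n = (\<Union>u\<in>U n. ball u (\<eta> n))" for n
      define r where "r n = d n + 2 * \<eta> n" for n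
      have r: "0 < r n" for n using d0[of n] \<eta>(1)[of n] by (simp add: r_def)
      have VU: "U n \<subseteq> V n" for n using \<eta>(1) by (force simp: V_def)
      have "X \<subseteq> (\<Union>n. V n)"
      proof
        fix x assume "x \<in> X"
        then obtain n where "x \<in> U n" using U(2) by blast
        then show "x \<in> (\<Union>n. V n)" using VU[of n] by blast
      qed
      then obtain D where D: "finite D" "X \<subseteq> (\<Union>n\<in>D. V n)"
        by (rule compactE_image[OF X, of UNIV V, rotated]) (auto simp: V_def)
      have Vr: "dist x x' \<le> r n" if V: "x \<in> V n" "x' \<in> V n" for x x' n
      proof -
        obtain u u' where u: "u \<in> U n" "u' \<in> U n" "dist u x < \<eta> n" "dist u' x' < \<eta> n"
          using V by (auto simp: V_def)
        have "dist u u' \<le> d n" unfolding d_def by (rule diameter_bounded_bound[OF U(1) u(1,2)])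
        moreover have "dist x x' \<le> dist u x + dist u u' + dist u' x'"
          using dist_triangle[of x x' u] dist_triangle[of u x' u'] by (simp add: dist_commute)
        ultimately show ?thesis using u unfolding r_def by linarith
      qed
      \<comment> \<open>The threshold depends on the radius but not on the set, so the finitely many
        sets of the subcover share one level \<open>N\<close>.\<close>
      obtain N0 where N0: "\<And>n N S. N0 n \<le> N \<Longrightarrow> (\<forall>u\<in>S. \<forall>v\<in>S. dist u v \<le> r n) \<Longrightarrow>
         (\<Sum>w\<in>{w \<in> W N. y w \<in> S}. p w) \<le> C * r n powr s"
        using mass[OF r] by metis
      define N where "N = Max (insert 0 (N0 ` D))"
      have N: "N0 n \<le> N" if "n \<in> D" for n
        unfolding N_def using D that by (intro Max_ge) auto
      have "1 = (\<Sum>w\<in>W N. p w)" by (simp add: W)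
      also have "\<dots> \<le> (\<Sum>w\<in>W N. \<Sum>n\<in>D. if y w \<in> V n then p w else 0)"
      proof (rule sum_mono)
        fix w
        obtain n where n: "n \<in> D" "y w \<in> V n" using y[of w] D(2) by blast
        have "(if y w \<in> V n then p w else 0) \<le> (\<Sum>n\<in>D. if y w \<in> V n then p w else 0)"
          by (rule member_le_sum[OF n(1)]) (use D W in auto)
        then show "p w \<le> (\<Sum>n\<in>D. if y w \<in> V n then p w else 0)" using n by simp
      qed
      also have "\<dots> = (\<Sum>n\<in>D. \<Sum>w\<in>{w \<in> W N. y w \<in> V n}. p w)"
        by (subst sum.swap) (simp add: sum.inter_filter W)
      also have "\<dots> \<le> (\<Sum>n\<in>D. C * r n powr s)"
        using N0[OF N] Vr by (intro sum_mono) blast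
      also have "\<dots> = C * (\<Sum>n\<in>D. r n powr s)" by (simp add: sum_distrib_left)
      finally have "1 / C \<le> (\<Sum>n\<in>D. r n powr s)" using C by (simp add: field_simps)
      also have "\<dots> \<le> (\<Sum>n\<in>D. d n powr s + \<epsilon> * (1/2)^Suc n)"
        unfolding r_def by (intro sum_mono \<eta>)
      also have "\<dots> = (\<Sum>n\<in>D. d n powr s) + \<epsilon> * (\<Sum>n\<in>D. (1/2)^Suc n)"
        by (simp add: sum.distrib sum_distrib_left)
      also have "(\<Sum>n\<in>D. (1/2::real)^Suc n) \<le> (\<Sum>n. (1/2)^Suc n)"
        by (rule sum_le_suminf) (use power_half_series D in \<open>auto simp: sums_iff\<close>)
      also have "(\<Sum>n. (1/2::real)^Suc n) = 1" using power_half_series by (simp add: sums_iff)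
      finally have "1 / C \<le> (\<Sum>n\<in>D. d n powr s) + \<epsilon>" using \<epsilon> by simp
      then have "ennreal (1 / C) \<le> ennreal ((\<Sum>n\<in>D. d n powr s) + \<epsilon>)" by (rule ennreal_leI)
      also have "\<dots> = (\<Sum>n\<in>D. diam_pow s (U n)) + ennreal \<epsilon>"
        using s \<epsilon> by (simp add: diam_pow_eq d_def[symmetric] sum_nonneg)
      also have "(\<Sum>n\<in>D. diam_pow s (U n)) \<le> (\<Sum>n. diam_pow s (U n))"
        by (rule sum_le_suminf) (use D in auto)
      finally show "ennreal (1 / C) \<le> (\<Sum>n. diam_pow s (U n)) + ennreal \<epsilon>" by simp
    qed
  qed
  also have "\<dots> \<le> hausdorff_measure s X"
    unfolding hausdorff_measure_def by (rule SUP_upper) simp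
  finally have "ennreal (1 / C) \<le> hausdorff_measure s X" .
  moreover have "0 < ennreal (1 / C)" using C by simp
  ultimately show ?thesis by (rule less_le_trans[rotated])
qed

context diag_ifs
begin

lemma fw_mem: "x \<in> A t \<Longrightarrow> fw (diag_affine a c t) w x \<in> A t"
  using fw_cover[OF A_eq, of t "length w"] by (auto simp: words_def)

lemma wprod_p: "wprod p w = \<bar>wprod c w\<bar> * \<bar>wprod a w\<bar> powr (s - 1)"
  unfolding p_def wprod_mult abs_wprod by (subst wprod_powr) auto

lemma wprod_p_le_1: "wprod p w \<le> 1"
proof -
  have "p i \<le> 1" for i
    unfolding p_sum[symmetric] by (rule member_le_sum) (auto simp: p_nonneg)
  then have "wprod p w \<le> wprod (\<lambda>_. 1) w" by (intro wprod_mono p_nonneg)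
  then show ?thesis by (simp add: wprod_const)
qed

lemma abs_wprod_a_le: "\<bar>wprod a w\<bar> \<le> (1/2) ^ length w"
proof -
  have "\<bar>a i\<bar> \<le> 1/2" for i using ac[of i] by linarith
  then have "\<bar>wprod a w\<bar> \<le> wprod (\<lambda>_. 1/2) w"
    unfolding abs_wprod by (intro wprod_mono) auto
  then show ?thesis by (simp add: wprod_const)
qed

text \<open>By the horizontal separation, all cylinders of a deep level that meet a set of diameter \<open>r\<close>
  lie in one cylinder of width comparable to \<open>r\<close>; the mass it puts in a horizontal strip is
  controlled by the vertical density.\<close>

lemma cylinder_mass:
  assumes sep: "separated t \<delta>" and reg: "regular t K" and x0: "x0 \<in> A t"
  obtains C where "0 < C"
    "\<And>r. 0 < r \<Longrightarrow> \<exists>N0. \<forall>N\<ge>N0. \<forall>S. (\<forall>u\<in>S. \<forall>v\<in>S. dist u v \<le> r) \<longrightarrow>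
       (\<Sum>w\<in>{w \<in> words N. fw (diag_affine a c t) w x0 \<in> S}. wprod p w) \<le> C * r powr s"
proof -
  let ?f = "diag_affine a c t"
  obtain C1 where C1: "0 < C1"
    "\<And>N x l. 0 < l \<Longrightarrow> (\<Sum>w\<in>{w \<in> words N. \<bar>ypos t w - x\<bar> \<le> l}. wprod p w) \<le> C1 * (l + (1/2)^N)"
    by (rule regular_imp_density[OF reg]) blast
  have \<delta>: "0 < \<delta>" using sep by (simp add: separated_def)
  define M where "M = 2 * norm t"
  have M: "0 \<le> M" "\<bar>x0 $ 2\<bar> \<le> M" using A_component_bound[OF x0] by (auto simp: M_def)
  define D where "D = (1 / \<delta>) powr (s - 1)"
  have D: "0 < D" using \<delta> by (simp add: D_def)
  have pw: "0 \<le> wprod p w" for w by (intro wprod_nonneg p_nonneg)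
  show thesis
  proof
    show "0 < C1 * (D + 1)" using C1 D by simp
    fix r :: real assume r: "0 < r"
    \<comment> \<open>From length \<open>k0\<close> on, every cylinder has width ratio at most
      \<open>r / \<delta>\<close>. This bounds the length of the common prefix independently of the
      set \<open>S\<close>.\<close>
    obtain k0 where "(1/2) ^ k0 < r / \<delta>" using real_arch_pow_inv[of "r / \<delta>" "1/2"] r \<delta> by auto
    then have k0: "(1/2) ^ k0 * \<delta> \<le> r" using \<delta> by (simp add: field_simps)
    have rs: "0 < r powr s" using r by simp
    \<comment> \<open>Chooses the level so deep that the additive error
      \<open>(1/2) ^ (N - k)\<close> of the density bound, with \<open>k \<le> k0\<close>, is
      absorbed by \<open>r powr s\<close>.\<close>
    have "(\<lambda>N. (2 * M + 1) * 2 ^ k0 * (1/2) ^ N) \<longlonglongrightarrow> (2 * M + 1) * 2 ^ k0 * 0"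
      by (intro tendsto_intros LIMSEQ_power_zero) auto
    then have "\<forall>\<^sub>F N in sequentially. (2 * M + 1) * 2 ^ k0 * (1/2) ^ N < r powr s"
      by (rule order_tendstoD) (use rs in simp)
    then obtain N1 where N1: "\<And>N. N1 \<le> N \<Longrightarrow> (2 * M + 1) * 2 ^ k0 * (1/2) ^ N < r powr s"
      by (auto simp: eventually_sequentially)
    show "\<exists>N0. \<forall>N\<ge>N0. \<forall>S. (\<forall>u\<in>S. \<forall>v\<in>S. dist u v \<le> r) \<longrightarrow>
       (\<Sum>w\<in>{w \<in> words N. fw ?f w x0 \<in> S}. wprod p w) \<le> C1 * (D + 1) * r powr s"
    proof (intro exI[of _ "max k0 N1"] allI impI)
      fix N and S :: "(real ^ 2) set" assume N: "max k0 N1 \<le> N" and S: "\<forall>u\<in>S. \<forall>v\<in>S. dist u v \<le> r"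
      define H where "H = {w \<in> words N. fw ?f w x0 \<in> S}"
      have comp: "\<bar>fw ?f I x0 $ b - fw ?f J x0 $ b\<bar> \<le> r" if "I \<in> H" "J \<in> H" for I J b
      proof -
        have "dist (fw ?f I x0) (fw ?f J x0) \<le> r" using S that by (auto simp: H_def)
        then show ?thesis
          using component_le_norm_cart[of "fw ?f I x0 - fw ?f J x0" b] by (simp add: dist_norm)
      qed
      show "(\<Sum>w\<in>H. wprod p w) \<le> C1 * (D + 1) * r powr s"
      proof (cases "H = {}")
        case True
        then show ?thesis using C1 D by simp
      next
        case False
        then obtain I where I: "I \<in> H" by blast
        have lenI: "length I = N" using I by (simp add: H_def words_def)
        define P where "P k \<longleftrightarrow> \<bar>wprod a (take k I)\<bar> * \<delta> \<le> r" for k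
        have "P k0"
        proof -
          have "\<bar>wprod a (take k0 I)\<bar> * \<delta> \<le> (1/2) ^ k0 * \<delta>"
            using abs_wprod_a_le[of "take k0 I"] lenI N \<delta> by (intro mult_right_mono) (auto simp: min_absorb2)
          then show ?thesis using k0 unfolding P_def by linarith
        qed
        \<comment> \<open>Minimality forces the common prefix: a word leaving \<open>I\<close>
          before place \<open>k\<close> would be separated from it horizontally by more than
          \<open>r\<close>.\<close>
        define k where "k = (LEAST k. P k)"
        have Pk: "P k" and kk0: "k \<le> k0" and notP: "\<And>l. l < k \<Longrightarrow> \<not> P l"
          unfolding k_def using \<open>P k0\<close> by (auto intro: LeastI Least_le dest: not_less_Least)
        have kN: "k \<le> N" using kk0 N by simp
        define w where "w = take k I"
        have lenw: "length w = k" using lenI kN by (simp add: w_def)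
        have pre: "take k J = w" if J: "J \<in> H" for J
        proof (rule ccontr)
          assume "take k J \<noteq> w"
          moreover have lenJ: "length J = N" using J by (simp add: H_def words_def)
          ultimately obtain z i j u' v' where z: "i \<noteq> j" "w = z @ i # u'" "take k J = z @ j # v'"
            using longest_common_prefix_split[of w "take k J"] lenw kN by (metis length_take min_absorb2)
          have "length z < k" using lenw z(2) by simp
          moreover have "take (length z) I = z"
          proof -
            have "take (length z) I = take (length z) (take k I)" using \<open>length z < k\<close> by (simp add: min_absorb1)
            also have "\<dots> = z" using z(2) by (simp add: w_def)
            finally show ?thesis .
          qed
          ultimately have gt: "r < \<delta> * \<bar>wprod a z\<bar>"
            using notP[of "length z"] by (simp add: P_def mult.commute)
          have eqs: "I = z @ i # (u' @ drop k I)" "J = z @ j # (v' @ drop k J)"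
            using z append_take_drop_id[of k I] append_take_drop_id[of k J] by (auto simp: w_def)
          have "\<delta> * \<bar>wprod a z\<bar> \<le> \<bar>fw ?f I x0 $ 1 - fw ?f J x0 $ 1\<bar>"
            using separated_words[OF sep z(1) x0 x0, of z "u' @ drop k I" "v' @ drop k J"]
            unfolding eqs[symmetric] .
          then show False using comp[OF I J, of 1] gt by linarith
        qed
        define n where "n = N - k"
        \<comment> \<open>The height of the point of \<open>I\<close> before \<open>w\<close> is
          applied. Undoing \<open>w\<close> turns the vertical tolerance \<open>r\<close> into
          \<open>r / |wprod c w|\<close>, and \<open>M * (1/2) ^ n\<close> pays for replacing
          \<open>x0\<close> by the origin.\<close>
        define X where "X = ypos t (drop k I) + wprod c (drop k I) * x0 $ 2"
        have cw: "0 < \<bar>wprod c w\<bar>" by (rule abs_wprod_c_pos)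
        define l where "l = r / \<bar>wprod c w\<bar> + M * (1/2) ^ n"
        have l: "0 < l" using r cw M by (simp add: l_def add_pos_nonneg)
        define Q where "Q = {v \<in> words n. \<bar>ypos t v - X\<bar> \<le> l}"
        have "H \<subseteq> (\<lambda>v. w @ v) ` Q"
        proof
          fix J assume J: "J \<in> H"
          have J': "J = w @ drop k J" using pre[OF J] append_take_drop_id[of k J] by simp
          have I': "I = w @ drop k I" using append_take_drop_id[of k I] by (simp add: w_def)
          define v where "v = drop k J"
          have v: "v \<in> words n" using J by (simp add: v_def n_def words_def H_def)
          have y: "fw ?f (w @ v) x0 $ 2 = ypos t w + wprod c w * (ypos t v + wprod c v * x0 $ 2)" for v
            unfolding fw_diag_affine ypos_def pt_append by (simp add: algebra_simps)
          have "\<bar>fw ?f J x0 $ 2 - fw ?f I x0 $ 2\<bar> \<le> r" by (rule comp[OF J I])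
          moreover have "fw ?f J x0 $ 2 - fw ?f I x0 $ 2 = wprod c w * (ypos t v + wprod c v * x0 $ 2 - X)"
            using y[of v] y[of "drop k I"] J' I' unfolding v_def X_def by (simp add: algebra_simps)
          ultimately have "\<bar>wprod c w\<bar> * \<bar>ypos t v + wprod c v * x0 $ 2 - X\<bar> \<le> r"
            by (simp add: abs_mult)
          then have "\<bar>ypos t v + wprod c v * x0 $ 2 - X\<bar> \<le> r / \<bar>wprod c w\<bar>"
            using cw by (simp add: field_simps)
          moreover have "\<bar>wprod c v * x0 $ 2\<bar> \<le> (1/2) ^ n * M"
            unfolding abs_mult using abs_wprod_c_le[of v] v M by (intro mult_mono) (auto simp: words_def)
          ultimately have "\<bar>ypos t v - X\<bar> \<le> l" unfolding l_def by (simp add: mult.commute)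
          then show "J \<in> (\<lambda>v. w @ v) ` Q" using v J' by (auto simp: Q_def v_def)
        qed
        moreover have finQ: "finite Q" by (simp add: Q_def)
        ultimately have "(\<Sum>u\<in>H. wprod p u) \<le> (\<Sum>u\<in>(\<lambda>v. w @ v) ` Q. wprod p u)"
          by (intro sum_mono2) (auto simp: pw)
        also have "\<dots> = wprod p w * (\<Sum>v\<in>Q. wprod p v)"
          by (subst sum.reindex) (auto simp: inj_on_def sum_distrib_left)
        also have "\<dots> \<le> wprod p w * (C1 * (l + (1/2)^n))"
          unfolding Q_def by (intro mult_left_mono C1(2) l pw)
        also have "\<dots> = C1 * (wprod p w * (r / \<bar>wprod c w\<bar>) + wprod p w * ((M + 1) * (1/2)^n))"
          by (simp add: l_def algebra_simps)
        also have "\<dots> \<le> C1 * (D * r powr s + r powr s)"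
        proof (intro mult_left_mono add_mono)
          have "\<bar>wprod a w\<bar> \<le> r / \<delta>" using Pk \<delta> unfolding P_def w_def by (simp add: field_simps)
          then have "\<bar>wprod a w\<bar> powr (s - 1) \<le> (r * (1 / \<delta>)) powr (s - 1)"
            using s_gt by (intro powr_mono2) auto
          also have "\<dots> = D * r powr (s - 1)"
            using r \<delta> unfolding D_def by (subst powr_mult) auto
          finally have "\<bar>wprod a w\<bar> powr (s - 1) * r \<le> D * r powr (s - 1) * r"
            using r by (intro mult_right_mono) auto
          also have "\<dots> = D * r powr s" using r by (simp add: powr_diff)
          finally show "wprod p w * (r / \<bar>wprod c w\<bar>) \<le> D * r powr s"
            using cw by (simp add: wprod_p)
          have "(1/2::real) ^ n = 2 ^ k * (1/2) ^ N"
            unfolding n_def using kN by (simp add: power_diff power_one_over field_simps)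
          also have "\<dots> \<le> 2 ^ k0 * (1/2) ^ N"
            using kk0 by (intro mult_right_mono power_increasing) auto
          finally have "(M + 1) * (1/2) ^ n \<le> (2 * M + 1) * (2 ^ k0 * (1/2) ^ N)"
            using M by (intro mult_mono) auto
          also have "\<dots> \<le> r powr s" using N1[of N] N by (simp add: mult.assoc)
          finally have "wprod p w * ((M + 1) * (1/2) ^ n) \<le> 1 * (r powr s)"
            using M by (intro mult_mono wprod_p_le_1) auto
          then show "wprod p w * ((M + 1) * (1/2) ^ n) \<le> r powr s" by simp
        qed (use C1 in simp)
        also have "\<dots> = C1 * (D + 1) * r powr s" by (simp add: algebra_simps)
        finally show ?thesis .
      qed
    qed
  qed
qed

lemma hausdorff_measure_pos:
  assumes "separated t \<delta>" "regular t K"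
  shows "0 < hausdorff_measure s (A t)"
proof -
  obtain x0 where x0: "x0 \<in> A t" using A_ne by blast
  obtain C where C: "0 < C"
    "\<And>r. 0 < r \<Longrightarrow> \<exists>N0. \<forall>N\<ge>N0. \<forall>S. (\<forall>u\<in>S. \<forall>v\<in>S. dist u v \<le> r) \<longrightarrow>
       (\<Sum>w\<in>{w \<in> words N. fw (diag_affine a c t) w x0 \<in> S}. wprod p w) \<le> C * r powr s"
    by (rule cylinder_mass[OF assms x0]) blast
  show ?thesis
    by (rule mass_distribution_compact[OF A_compact _ C(1), where W = words and p = "wprod p" and
          y = "\<lambda>w. fw (diag_affine a c t) w x0"])
      (use s_gt C(2) in \<open>auto simp: sum_wprod p_sum intro: wprod_nonneg p_nonneg fw_mem x0\<close>)
qed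

text \<open>Holds for every \<open>t\<close>: cut each cylinder into about
  \<open>|wprod c w| / |wprod a w|\<close> pieces whose diameter is of order
  \<open>|wprod a w|\<close>. The number of pieces times \<open>|wprod a w| powr s\<close> is of
  order \<open>wprod p w\<close>, and these masses sum to 1.\<close>

lemma hausdorff_measure_finite: "hausdorff_measure s (A t) < \<infinity>"
proof -
  let ?f = "diag_affine a c t"
  define M where "M = 2 * norm t + 1"
  have M: "0 < M" by (simp add: M_def add_nonneg_pos)
  have MA: "\<bar>x $ b\<bar> \<le> M" if "x \<in> A t" for x b
    using A_component_bound[OF that, of b] by (simp add: M_def)
  have "hausdorff_premeasure s \<delta> (A t) \<le> ennreal (3 * (4 * M) powr s)" if \<delta>: "0 < \<delta>" for \<delta>
  proof -
    obtain N where "(1/2) ^ N < \<delta> / (4 * M)"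
      using real_arch_pow_inv[of "\<delta> / (4 * M)" "1/2"] \<delta> M by auto
    then have N: "4 * M * (1/2) ^ N \<le> \<delta>" using M by (simp add: field_simps)
    \<comment> \<open>Rounding up and adding one more piece costs at most a factor 3, since the
      ratio is at least 1.\<close>
    define m where "m w = nat \<lceil>\<bar>wprod c w\<bar> / \<bar>wprod a w\<bar>\<rceil>" for w
    have ratio: "1 \<le> \<bar>wprod c w\<bar> / \<bar>wprod a w\<bar>" for w
    proof -
      have "\<bar>wprod a w\<bar> \<le> \<bar>wprod c w\<bar>"
        unfolding abs_wprod using ac by (intro wprod_mono) (auto intro: less_imp_le)
      then show ?thesis using abs_wprod_a_pos[of w] by simp
    qed
    have m: "\<bar>wprod c w\<bar> / \<bar>wprod a w\<bar> \<le> m w" "real (m w) + 1 \<le> 3 * (\<bar>wprod c w\<bar> / \<bar>wprod a w\<bar>)" "0 < m w" for w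
      using ratio[of w] unfolding m_def by linarith+
    define U where "U = (\<lambda>(w, j). fw ?f w ` {x \<in> A t. real j \<le> (x $ 2 + M) * m w / (2 * M) \<and>
        (x $ 2 + M) * m w / (2 * M) \<le> real j + 1})"
    \<comment> \<open>The index \<open>m w\<close> is included for points at height exactly
      \<open>M\<close>, where the floor of the rescaled height is \<open>m w\<close> itself.\<close>
    define I where "I = Sigma (words N :: 'i list set) (\<lambda>w. {..m w})"
    have I: "finite I" by (simp add: I_def)
    have dist: "norm (x - y) \<le> 4 * M * \<bar>wprod a w\<bar>" if "x \<in> U (w, j)" "y \<in> U (w, j)" for x y w j
    proof -
      obtain x' y' where x': "x' \<in> A t" "x = fw ?f w x'" "real j \<le> (x' $ 2 + M) * m w / (2 * M)"
          "(x' $ 2 + M) * m w / (2 * M) \<le> real j + 1"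
        and y': "y' \<in> A t" "y = fw ?f w y'" "real j \<le> (y' $ 2 + M) * m w / (2 * M)"
          "(y' $ 2 + M) * m w / (2 * M) \<le> real j + 1"
        using \<open>x \<in> U (w, j)\<close> \<open>y \<in> U (w, j)\<close> by (auto simp: U_def)
      have "\<bar>x' $ 1 - y' $ 1\<bar> \<le> 2 * M" using MA[OF x'(1), of 1] MA[OF y'(1), of 1] by linarith
      then have "\<bar>wprod a w\<bar> * \<bar>x' $ 1 - y' $ 1\<bar> \<le> \<bar>wprod a w\<bar> * (2 * M)" by (intro mult_left_mono) auto
      then have 1: "\<bar>(x - y) $ 1\<bar> \<le> 2 * M * \<bar>wprod a w\<bar>"
        by (simp add: x'(2) y'(2) fw_diag_affine abs_mult[symmetric] right_diff_distrib mult.commute)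
      have "\<bar>(x' $ 2 + M) * m w / (2 * M) - (y' $ 2 + M) * m w / (2 * M)\<bar> \<le> 1"
        using x' y' by linarith
      moreover have "(x' $ 2 + M) * m w / (2 * M) - (y' $ 2 + M) * m w / (2 * M) = (x' $ 2 - y' $ 2) * (m w / (2 * M))"
        by (simp add: diff_divide_distrib[symmetric] left_diff_distrib[symmetric])
      ultimately have "\<bar>x' $ 2 - y' $ 2\<bar> * (m w / (2 * M)) \<le> 1"
        using M by (simp add: abs_mult)
      then have *: "\<bar>x' $ 2 - y' $ 2\<bar> * m w \<le> 2 * M" using M by (simp add: field_simps)
      have "\<bar>wprod c w\<bar> * \<bar>x' $ 2 - y' $ 2\<bar> \<le> (\<bar>wprod a w\<bar> * m w) * \<bar>x' $ 2 - y' $ 2\<bar>"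
        using m(1)[of w] abs_wprod_a_pos[of w] by (intro mult_right_mono) (auto simp: field_simps)
      also have "\<dots> = \<bar>wprod a w\<bar> * (\<bar>x' $ 2 - y' $ 2\<bar> * m w)" by simp
      also have "\<dots> \<le> \<bar>wprod a w\<bar> * (2 * M)" by (intro mult_left_mono *) auto
      finally have 2: "\<bar>(x - y) $ 2\<bar> \<le> 2 * M * \<bar>wprod a w\<bar>"
        by (simp add: x'(2) y'(2) fw_diag_affine abs_mult[symmetric] right_diff_distrib mult.commute)
      have "norm (x - y) \<le> \<bar>(x - y) $ 1\<bar> + \<bar>(x - y) $ 2\<bar>"
        using norm_le_l1_cart[of "x - y"] by (simp add: sum_2)
      then show ?thesis using 1 2 by linarith
    qed
    have diam: "diameter (U (w, j)) \<le> 4 * M * \<bar>wprod a w\<bar>" for w j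
      by (rule diameter_le) (use dist M in auto)
    have "hausdorff_premeasure s \<delta> (A t) \<le> (\<Sum>i\<in>I. diam_pow s (U i))"
    proof (rule hausdorff_premeasure_le_finite_cover[OF I])
      fix i assume "i \<in> I"
      then obtain w j where i: "i = (w, j)" "w \<in> words N" by (auto simp: I_def)
      have "U i \<subseteq> A t" unfolding U_def i using fw_mem by auto
      then have "bounded (U i)" using A_compact compact_imp_bounded bounded_subset by blast
      moreover have "4 * M * \<bar>wprod a w\<bar> \<le> 4 * M * (1/2) ^ N"
        using abs_wprod_a_le[of w] i(2) M by (intro mult_left_mono) (auto simp: words_def)
      then have "diameter (U i) \<le> \<delta>" using diam[of w j] N unfolding i by linarith
      ultimately show "bounded (U i) \<and> diameter (U i) \<le> \<delta>" ..
    next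
      show "A t \<subseteq> (\<Union>i\<in>I. U i)"
      proof
        fix x assume "x \<in> A t"
        then obtain w x' where w: "w \<in> words N" "x' \<in> A t" "x = fw ?f w x'"
          using fw_cover[OF A_eq, of t N] by blast
        define h where "h = (x' $ 2 + M) * m w / (2 * M)"
        have "- M \<le> x' $ 2" "x' $ 2 \<le> M" using MA[OF w(2), of 2] by linarith+
        then have h0: "0 \<le> h" using M by (simp add: h_def)
        have "(x' $ 2 + M) * m w \<le> (2 * M) * m w" using \<open>x' $ 2 \<le> M\<close> by (intro mult_right_mono) auto
        then have h1: "h \<le> m w" using M by (simp add: h_def field_simps)
        have "nat \<lfloor>h\<rfloor> \<le> m w" "real (nat \<lfloor>h\<rfloor>) \<le> h" "h \<le> real (nat \<lfloor>h\<rfloor>) + 1"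
          using h0 h1 by linarith+
        then have "(w, nat \<lfloor>h\<rfloor>) \<in> I" "x \<in> U (w, nat \<lfloor>h\<rfloor>)"
          using w unfolding I_def U_def h_def by auto
        then show "x \<in> (\<Union>i\<in>I. U i)" by blast
      qed
    qed (use \<delta> in simp)
    also have "\<dots> \<le> (\<Sum>(w, j)\<in>I. ennreal ((4 * M * \<bar>wprod a w\<bar>) powr s))"
    proof (rule sum_mono, clarify)
      fix w j assume wj: "(w, j) \<in> I"
      have "bounded (U (w, j))"
        using A_compact[of t] fw_mem by (intro bounded_subset[OF compact_imp_bounded]) (auto simp: U_def)
      then have "0 \<le> diameter (U (w, j))" by (rule diameter_ge_0)
      then show "diam_pow s (U (w, j)) \<le> ennreal ((4 * M * \<bar>wprod a w\<bar>) powr s)"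
        using diam[of w j] s_gt by (subst diam_pow_eq) (auto intro!: ennreal_leI powr_mono2)
    qed
    also have "\<dots> = (\<Sum>w\<in>words N. \<Sum>j\<in>{..m w}. ennreal ((4 * M * \<bar>wprod a w\<bar>) powr s))"
      unfolding I_def by (rule sum.Sigma[symmetric]) auto
    also have "\<dots> = (\<Sum>w\<in>words N. ennreal ((real (m w) + 1) * (4 * M * \<bar>wprod a w\<bar>) powr s))"
      by (intro sum.cong refl) (simp add: ennreal_mult' ennreal_of_nat_eq_real_of_nat ennreal_plus[symmetric] add.commute del: ennreal_plus)
    also have "\<dots> \<le> (\<Sum>w\<in>words N. ennreal (3 * (4 * M) powr s * wprod p w))"
    proof (intro sum_mono ennreal_leI)
      fix w
      have aw: "0 < \<bar>wprod a w\<bar>" by (rule abs_wprod_a_pos)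
      have "(real (m w) + 1) * (4 * M * \<bar>wprod a w\<bar>) powr s
         \<le> 3 * (\<bar>wprod c w\<bar> / \<bar>wprod a w\<bar>) * (4 * M * \<bar>wprod a w\<bar>) powr s"
        using m(2) by (intro mult_right_mono) auto
      also have "\<dots> = 3 * (\<bar>wprod c w\<bar> / \<bar>wprod a w\<bar>) * ((4 * M) powr s * \<bar>wprod a w\<bar> powr s)"
        using M by (subst powr_mult) auto
      also have "\<dots> = 3 * (4 * M) powr s * wprod p w"
        using aw by (simp add: wprod_p powr_diff)
      finally show "(real (m w) + 1) * (4 * M * \<bar>wprod a w\<bar>) powr s \<le> 3 * (4 * M) powr s * wprod p w" .
    qed
    also have "\<dots> = ennreal (\<Sum>w\<in>words N. 3 * (4 * M) powr s * wprod p w)"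
      using M by (intro sum_ennreal mult_nonneg_nonneg wprod_nonneg p_nonneg) auto
    also have "(\<Sum>w\<in>words N. 3 * (4 * M) powr s * wprod p w) = 3 * (4 * M) powr s"
      by (simp add: sum_distrib_left[symmetric] sum_wprod p_sum)
    finally show ?thesis .
  qed
  then have "hausdorff_measure s (A t) \<le> ennreal (3 * (4 * M) powr s)"
    unfolding hausdorff_measure_def by (intro SUP_least) auto
  then show ?thesis by (rule le_less_trans) simp
qed

end

theorem proposition4p1:
  fixes a c :: "'i::finite \<Rightarrow> real" and s\<^sub>0 :: real
  assumes "\<And>i. 0 < \<bar>a i\<bar> \<and> \<bar>a i\<bar> < \<bar>c i\<bar> \<and> \<bar>c i\<bar> < 1/2"
    and "(\<Sum>i\<in>UNIV. \<bar>c i\<bar> * \<bar>a i\<bar> powr (1/4)) > 1"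
    and "(\<Sum>i\<in>UNIV. \<bar>a i\<bar> powr (1/2)) < 1"
    and "(\<Sum>i\<in>UNIV. \<bar>c i\<bar> * \<bar>a i\<bar> powr (s\<^sub>0 - 1)) = 1"
  shows "AE t :: real ^ 2 ^ 'i in lebesgue.
           0 < hausdorff_measure s\<^sub>0 (attractor (diag_affine a c t)) \<and>
           hausdorff_measure s\<^sub>0 (attractor (diag_affine a c t)) < \<infinity>"
proof -
  interpret diag_ifs a c s\<^sub>0
    using assms by unfold_locales auto
  have "AE t in lebesgue. \<exists>K. regular t K"
    by (rule AE_completion[OF AE_regular])
  with AE_separated show ?thesis
    by eventually_elim (use hausdorff_measure_pos hausdorff_measure_finite in blast)
qed

end
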